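(* Let $\mathcal P$ be a primitive integral triangular packing. (i) Suppose every curvature of $\mathcal P$ is $\equiv 1\pmod{12}$, and that $\left(\frac{a+b}{a}\right)=-1$ for every pair of tangent circles of $\mathcal P$ with curvatures $a\neq0$, $b$ and $\gcd(a,b)=1$. Then no circle of $\mathcal P$ has curvature $n^2$ with $n$ an integer. (ii) Suppose every curvature of $\mathcal P$ is congruent to $3$ or $11$ modulo $12$, and that for every pair of tangent circles with curvatures $a\neq 0$, $b$, $\gcd(a,b)=1$, the quantity $\chi(a,b)$, defined as $\left(\frac{a+b}{a}\right)$ if $a\equiv 11\pmod{12}$ and $-\left(\frac{a+b}{a}\right)$ if $a\equiv 3\pmod{12}$, equals $-1$. Then no circle of $\mathcal P$ has curvature $3n^2$ with $n$ an integer.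
   Context: Generalized circles are circles and lines in the extended plane; each circle of a packing has signed curvature: $0$ for a line, $1/r$ for a circle of radius $r$, and $-1/r$ for a circle containing all other circles of the packing. A triangular-grid configuration is the image under a Möbius transformation $\mu$ of the circles of radius $1$ centered at the points $2m+2ne^{i\pi/3}$, $m,n\in\mathbb Z$ (tangency graph: the triangular lattice); its dual circles are the $\mu$-images of the circles of radius $1/\sqrt3$ centered at the centroids of the equilateral triangles formed by mutually adjacent centers. The triangular Apollonian group is generated by the inversions in the dual circles, and the triangular packing is the union of the orbit of the configuration. The packing is integral if all curvatures are integers and primitive if their gcd is $1$. $\left(\frac{m}{n}\right)$ is the Kronecker symbol: Legendre symbol for $n$ an odd prime; $\left(\frac m2\right)=0,1,-1$ according as $m$ is even, $\equiv\pm1$, or $\equiv\pm3\pmod 8$; $\left(\frac m{-1}\right)=1$ if $m\ge0$, $-1$ if $m<0$; $\left(\frac m1\right)=1$; multiplicative in $n$. *)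

theory Defs
  imports "HOL-Analysis.Analysis" "HOL-Number_Theory.Number_Theory"
begin

section \<open>Generalized circles in the extended plane\<close>

text \<open>The extended plane is \<^typ>\<open>complex option\<close>, with \<^term>\<open>None\<close> as the point at infinity.\<close>

type_synonym ecomplex = "complex option"

definition ecircle :: "complex \<Rightarrow> real \<Rightarrow> ecomplex set" where
  "ecircle c r = Some ` sphere c r"

definition eline :: "complex \<Rightarrow> complex \<Rightarrow> ecomplex set" where
  "eline p v = insert None (Some ` {p + of_real t * v | t. True})"

text \<open>Extension of \<^const>\<open>moebius\<close> to the extended plane; a bijection when
  \<open>a * d - b * c \<noteq> 0\<close>.\<close>

definition emoebius :: "complex \<Rightarrow> complex \<Rightarrow> complex \<Rightarrow> complex \<Rightarrow> ecomplex \<Rightarrow> ecomplex" where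
  "emoebius a b c d p = (case p of
      None \<Rightarrow> (if c = 0 then None else Some (a / c))
    | Some z \<Rightarrow> (if c * z + d = 0 then None else Some (moebius a b c d z)))"

definition circle_inversion :: "complex \<Rightarrow> real \<Rightarrow> ecomplex \<Rightarrow> ecomplex" where
  "circle_inversion c r p = (case p of
      None \<Rightarrow> Some c
    | Some z \<Rightarrow> (if z = c then None else Some (c + of_real (r\<^sup>2) / cnj (z - c))))"

definition line_reflection :: "complex \<Rightarrow> complex \<Rightarrow> ecomplex \<Rightarrow> ecomplex" where
  "line_reflection p v = map_option (\<lambda>z. p + v * cnj ((z - p) / v))"

text \<open>The inversion in a generalized circle, given as a point set. For a generalized circle
  \<open>D\<close> this set of maps is a singleton, since the maps do not depend on the choice of \<open>p\<close> and
  \<open>v\<close>.\<close>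

definition inversions_in :: "ecomplex set \<Rightarrow> (ecomplex \<Rightarrow> ecomplex) set" where
  "inversions_in D =
     {circle_inversion c r | c r. r > 0 \<and> D = ecircle c r} \<union>
     {line_reflection p v | p v. v \<noteq> 0 \<and> D = eline p v}"

text \<open>Distinct generalized circles are tangent iff they meet in exactly one point of the extended
  plane; parallel lines are tangent at infinity.\<close>

definition tangent :: "ecomplex set \<Rightarrow> ecomplex set \<Rightarrow> bool" where
  "tangent C D \<longleftrightarrow> C \<noteq> D \<and> (\<exists>p. C \<inter> D = {p})"


section \<open>Triangular packings\<close>

definition grid_centers :: "complex set" where
  "grid_centers = {2 * of_int m + 2 * of_int n * exp (\<i> * of_real (pi / 3)) | m n :: int. True}"

definition grid_circles :: "ecomplex set set" where
  "grid_circles = {ecircle w 1 | w. w \<in> grid_centers}"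

definition grid_dual_circles :: "ecomplex set set" where
  "grid_dual_circles = {ecircle ((u + v + w) / 3) (1 / sqrt 3) | u v w.
     u \<in> grid_centers \<and> v \<in> grid_centers \<and> w \<in> grid_centers \<and>
     tangent (ecircle u 1) (ecircle v 1) \<and> tangent (ecircle v 1) (ecircle w 1) \<and>
     tangent (ecircle w 1) (ecircle u 1)}"

text \<open>The group generated by the inversions in the members of \<open>\<D>\<close>. Inversions are involutions, so
  closure under inverses is automatic.\<close>

inductive_set inversion_group :: "ecomplex set set \<Rightarrow> (ecomplex \<Rightarrow> ecomplex) set"
  for \<D> :: "ecomplex set set" where
  id: "id \<in> inversion_group \<D>"
| step: "g \<in> inversion_group \<D> \<Longrightarrow> D \<in> \<D> \<Longrightarrow> s \<in> inversions_in D \<Longrightarrow> s \<circ> g \<in> inversion_group \<D>"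

definition triangular_apollonian_group :: "(ecomplex \<Rightarrow> ecomplex) \<Rightarrow> (ecomplex \<Rightarrow> ecomplex) set" where
  "triangular_apollonian_group \<mu> = inversion_group {\<mu> ` D | D. D \<in> grid_dual_circles}"

text \<open>A packing is represented by the set of its circles.\<close>

definition triangular_packing :: "ecomplex set set \<Rightarrow> bool" where
  "triangular_packing P \<longleftrightarrow> (\<exists>a b c d. a * d - b * c \<noteq> 0 \<and>
     P = {g ` (emoebius a b c d ` C) | g C.
            g \<in> triangular_apollonian_group (emoebius a b c d) \<and> C \<in> grid_circles})"


section \<open>Curvatures\<close>

definition contains_all_others :: "ecomplex set set \<Rightarrow> complex \<Rightarrow> real \<Rightarrow> bool" where
  "contains_all_others P c r \<longleftrightarrow> (\<forall>D \<in> P - {ecircle c r}. D \<subseteq> Some ` cball c r)"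

definition curvature :: "ecomplex set set \<Rightarrow> ecomplex set \<Rightarrow> real" where
  "curvature P C = (THE k.
     (\<exists>p v. v \<noteq> 0 \<and> C = eline p v \<and> k = 0) \<or>
     (\<exists>c r. r > 0 \<and> C = ecircle c r \<and>
        k = (if contains_all_others P c r then - 1 / r else 1 / r)))"

lemma ecircle_neq_eline: "ecircle c r \<noteq> eline p v"
  by (auto simp: ecircle_def eline_def)

lemma ecircle_eq_iff:
  assumes "r > 0" "s > 0"
  shows "ecircle c r = ecircle d s \<longleftrightarrow> c = d \<and> r = s"
proof
  assume "ecircle c r = ecircle d s"
  then have eq: "sphere c r = sphere d s"
    by (simp add: ecircle_def inj_image_eq_iff)
  have on: "cmod (z - d) = s" if "cmod (z - c) = r" for z
    using that eq by (metis dist_commute dist_norm mem_sphere)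
  define f where "f = d - c"
  have 1: "cmod (of_real r - f) = s" "cmod (- of_real r - f) = s"
    "cmod (of_real r * \<i> - f) = s" "cmod (- (of_real r * \<i>) - f) = s"
    using on[of "c + of_real r"] on[of "c - of_real r"] on[of "c + of_real r * \<i>"]
      on[of "c - of_real r * \<i>"] assms
    by (simp_all add: f_def norm_mult algebra_simps)
  note this[THEN arg_cong[where f = "\<lambda>x. x\<^sup>2"]]
  then have 2: "(r - Re f)\<^sup>2 + (Im f)\<^sup>2 = s\<^sup>2" "(r + Re f)\<^sup>2 + (Im f)\<^sup>2 = s\<^sup>2"
    "(Re f)\<^sup>2 + (r - Im f)\<^sup>2 = s\<^sup>2" "(Re f)\<^sup>2 + (r + Im f)\<^sup>2 = s\<^sup>2"
    unfolding cmod_power2 by (simp_all add: power2_eq_square algebra_simps)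
  have "(r + Re f)\<^sup>2 = (r - Re f)\<^sup>2" "(r + Im f)\<^sup>2 = (r - Im f)\<^sup>2"
    using 2 by linarith+
  then have "r * Re f = 0" "r * Im f = 0"
    by (simp_all add: power2_eq_square algebra_simps)
  then have "f = 0"
    using assms by (simp add: complex_eq_iff)
  then show "c = d \<and> r = s"
    using 1(1) assms by (simp add: f_def)
qed simp

lemma curvature_eline: "v \<noteq> 0 \<Longrightarrow> curvature P (eline p v) = 0"
  unfolding curvature_def
  by (rule the_equality) (use ecircle_neq_eline in metis)+

lemma curvature_ecircle:
  assumes "r > 0"
  shows "curvature P (ecircle c r) = (if contains_all_others P c r then - 1 / r else 1 / r)"
  unfolding curvature_def
proof (rule the_equality)
  fix k
  assume "(\<exists>p v. v \<noteq> 0 \<and> ecircle c r = eline p v \<and> k = 0) \<or>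
     (\<exists>c' r'. r' > 0 \<and> ecircle c r = ecircle c' r' \<and>
        k = (if contains_all_others P c' r' then - 1 / r' else 1 / r'))"
  then obtain c' r' where "r' > 0" "ecircle c r = ecircle c' r'"
    and k: "k = (if contains_all_others P c' r' then - 1 / r' else 1 / r')"
    using ecircle_neq_eline by blast
  with assms have "c' = c" "r' = r"
    by (simp_all add: ecircle_eq_iff)
  with k show "k = (if contains_all_others P c r then - 1 / r else 1 / r)"
    by simp
qed (use assms in blast)

definition integral_packing :: "ecomplex set set \<Rightarrow> bool" where
  "integral_packing P \<longleftrightarrow> (\<forall>C \<in> P. curvature P C \<in> \<int>)"

definition int_curvatures :: "ecomplex set set \<Rightarrow> int set" where
  "int_curvatures P = {k. \<exists>C \<in> P. curvature P C = of_int k}"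

definition primitive_packing :: "ecomplex set set \<Rightarrow> bool" where
  "primitive_packing P \<longleftrightarrow> Gcd (int_curvatures P) = 1"


section \<open>The Kronecker symbol\<close>

definition kronecker_prime :: "int \<Rightarrow> nat \<Rightarrow> int" where
  "kronecker_prime m p =
     (if p = 2 then (if even m then 0 else if m mod 8 \<in> {1, 7} then 1 else - 1)
      else Legendre m (int p))"

text \<open>The value at \<open>n = 0\<close> is the usual convention.\<close>

definition kronecker :: "int \<Rightarrow> int \<Rightarrow> int" where
  "kronecker m n =
     (if n = 0 then (if \<bar>m\<bar> = 1 then 1 else 0)
      else (if n < 0 \<and> m < 0 then - 1 else 1) *
           (\<Prod>p \<in># prime_factorization (nat \<bar>n\<bar>). kronecker_prime m p))"

text \<open>Only meaningful for \<open>a\<close> congruent to \<open>3\<close> or \<open>11\<close> modulo \<open>12\<close>.\<close>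

definition chi :: "int \<Rightarrow> int \<Rightarrow> int" where
  "chi a b = (if [a = 11] (mod 12) then kronecker (a + b) a else - kronecker (a + b) a)"

end

theory Submission
  imports Defs
begin

text \<open>A generalized circle is the zero set of a binary Hermitian form of norm 1, whose leading
  coefficient is the curvature up to sign. Moebius maps act on the forms by isometries and inversions
  by reflections, so a packing is a linear image of the orbit of the grid under a group of reflections
  of an integral lattice of rank 4.

  By primitivity the curvature functional \<open>l\<close> is a primitive integral functional on the lattice.
  The parabolic maps which fix a circle \<open>x\<close> and one of its neighbours produce circles tangent to
  \<open>x\<close> whose values under \<open>l\<close> form a two-parameter family, and when \<open>l x\<close> is odd some
  member of the family is coprime to \<open>l x\<close>. So a circle of curvature \<open>a = n\<^sup>2\<close> or
  \<open>a = 3 n\<^sup>2\<close> has a tangent circle of curvature \<open>b\<close> coprime to \<open>a\<close>, where the symbol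
  of \<open>a + b\<close> over the square part of \<open>a\<close> is 1, against the hypothesis. Signs of curvatures
  never matter for coprimality, so the orientation of the packing is irrelevant.\<close>

section \<open>Hermitian forms\<close>

type_synonym hform = "real \<times> complex \<times> real"

text \<open>The triple \<open>(\<alpha>, \<beta>, \<delta>)\<close> stands for the form
  \<open>\<alpha> \<bar>z\<bar>\<^sup>2 - 2 Re (cnj \<beta> z cnj w) + \<delta> \<bar>w\<bar>\<^sup>2\<close>; the product \<open>hpair\<close>
  polarizes the negative determinant \<open>\<bar>\<beta>\<bar>\<^sup>2 - \<alpha> \<delta>\<close>.\<close>
definition hpair :: "hform \<Rightarrow> hform \<Rightarrow> real" where
  "hpair x y = Re (fst (snd x) * cnj (fst (snd y))) - (fst x * snd (snd y) + fst y * snd (snd x)) / 2"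

definition hval :: "hform \<Rightarrow> complex \<times> complex \<Rightarrow> real" where
  "hval x z = fst x * (cmod (fst z))\<^sup>2 - 2 * Re (cnj (fst (snd x)) * fst z * cnj (snd z))
     + snd (snd x) * (cmod (snd z))\<^sup>2"

text \<open>Homogeneous coordinates on the extended plane; the junk value \<open>epoint 0 = None\<close> is never used.\<close>
definition epoint :: "complex \<times> complex \<Rightarrow> ecomplex" where
  "epoint z = (if snd z = 0 then None else Some (fst z / snd z))"

definition zeros :: "hform \<Rightarrow> ecomplex set" where
  "zeros x = epoint ` {z. z \<noteq> 0 \<and> hval x z = 0}"

lemma hval_scale: "hval x (k * z, k * w) = (cmod k)\<^sup>2 * hval x (z, w)"
  unfolding hval_def cmod_power2 by (simp add: power2_eq_square algebra_simps)

lemma epoint_eqD: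
  assumes "epoint z = epoint w" "z \<noteq> 0" "w \<noteq> 0"
  obtains k where "k \<noteq> 0" "w = (k * fst z, k * snd z)"
proof (cases "snd z = 0")
  case True
  with assms show ?thesis
    by (intro that[of "fst w / fst z"]) (auto simp: epoint_def prod_eq_iff split: if_splits)
next
  case False
  with assms show ?thesis
    by (intro that[of "snd w / snd z"]) (auto simp: epoint_def prod_eq_iff field_simps split: if_splits)
qed

lemma epoint_in_zeros_iff:
  assumes "z \<noteq> 0"
  shows "epoint z \<in> zeros x \<longleftrightarrow> hval x z = 0"
proof
  assume "epoint z \<in> zeros x"
  then obtain w where w: "w \<noteq> 0" "hval x w = 0" "epoint w = epoint z"
    unfolding zeros_def by auto
  then obtain k where "k \<noteq> 0" "z = (k * fst w, k * snd w)"
    using epoint_eqD assms by metis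
  then show "hval x z = 0"
    using w(2) hval_scale[of x k "fst w" "snd w"] by simp
qed (use assms in \<open>auto simp: zeros_def\<close>)

lemma Some_in_zeros_iff: "Some z \<in> zeros x \<longleftrightarrow> hval x (z, 1) = 0"
  using epoint_in_zeros_iff[of "(z, 1)" x] by (simp add: epoint_def prod_eq_iff)

lemma None_in_zeros_iff: "None \<in> zeros x \<longleftrightarrow> fst x = 0"
  using epoint_in_zeros_iff[of "(1, 0)" x] by (simp add: epoint_def prod_eq_iff hval_def)

text \<open>Serves inversions and Moebius maps alike: \<open>f\<close> lifts to the bijection
  \<open>\<phi>\<close> of homogeneous coordinates with inverse \<open>\<psi>\<close>, which
  respects the forms. Fixing 0 keeps nonzero coordinate vectors nonzero in both directions.\<close>

lemma image_zeros:
  assumes "\<And>z. z \<noteq> 0 \<Longrightarrow> f (epoint z) = epoint (\<phi> z)"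
    and "\<And>z. \<phi> (\<psi> z) = z" and "\<phi> 0 = 0" and "\<And>z. \<psi> (\<phi> z) = z"
    and "\<And>z. hval y (\<phi> z) = hval x z"
  shows "f ` zeros x = zeros y"
proof (intro equalityI subsetI)
  fix p assume "p \<in> f ` zeros x"
  then obtain z where z: "z \<noteq> 0" "hval x z = 0" "p = f (epoint z)"
    by (auto simp: zeros_def)
  have "\<phi> z \<noteq> 0"
    using z(1) assms(4)[of z] assms(2)[of 0] assms(3) assms(4)[of 0] by fastforce
  then show "p \<in> zeros y"
    using z by (simp add: assms(1,5) epoint_in_zeros_iff)
next
  fix p assume "p \<in> zeros y"
  then obtain z where z: "z \<noteq> 0" "hval y z = 0" "p = epoint z"
    by (auto simp: zeros_def)
  have "\<psi> z \<noteq> 0"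
    using z(1) assms(2)[of z] assms(3) by metis
  moreover have "hval x (\<psi> z) = 0"
    using assms(2)[of z] assms(5)[of "\<psi> z"] z(2) by simp
  ultimately have "f (epoint (\<psi> z)) \<in> f ` zeros x"
    by (simp add: epoint_in_zeros_iff)
  also have "f (epoint (\<psi> z)) = p"
    using assms(1)[OF \<open>\<psi> z \<noteq> 0\<close>] assms(2)[of z] z(3) by simp
  finally show "p \<in> f ` zeros x" .
qed

section \<open>Circles and lines as zero sets of forms of norm 1\<close>

lemma Some_in_ecircle_iff: "Some z \<in> ecircle c r \<longleftrightarrow> dist c z = r"
  and None_notin_ecircle: "None \<notin> ecircle c r"
  by (auto simp: ecircle_def)

lemma Some_in_eline_iff: "Some z \<in> eline p v \<longleftrightarrow> (\<exists>t. z = p + of_real t * v)"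
  and None_in_eline: "None \<in> eline p v"
  by (auto simp: eline_def)

text \<open>Completing the square: \<open>\<alpha>\<close> times the form at \<open>(z, 1)\<close>
  is the squared modulus of \<open>\<beta> - \<alpha> z\<close> minus the norm of the form, which is
  1.\<close>

lemma zeros_eq_ecircle:
  assumes "hpair x x = 1" "fst x \<noteq> 0"
  shows "zeros x = ecircle (fst (snd x) / of_real (fst x)) (1 / \<bar>fst x\<bar>)"
proof -
  obtain \<alpha> \<beta> \<delta> where x: "x = (\<alpha>, \<beta>, \<delta>)" by (cases x) auto
  have \<alpha>: "\<alpha> \<noteq> 0" and n: "(cmod \<beta>)\<^sup>2 - \<alpha> * \<delta> = 1"
    using assms by (simp_all add: x hpair_def cmod_power2) (simp_all add: power2_eq_square)
  have "hval x (z, 1) = 0 \<longleftrightarrow> dist (\<beta> / of_real \<alpha>) z = 1 / \<bar>\<alpha>\<bar>" for z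
  proof -
    have "\<alpha> * hval x (z, 1) = (cmod (\<beta> - of_real \<alpha> * z))\<^sup>2 - ((cmod \<beta>)\<^sup>2 - \<alpha> * \<delta>)"
      unfolding hval_def x cmod_power2 by (simp add: power2_eq_square algebra_simps)
    then have "hval x (z, 1) = 0 \<longleftrightarrow> (cmod (\<beta> - of_real \<alpha> * z))\<^sup>2 = 1"
      unfolding n using \<alpha> by (metis eq_iff_diff_eq_0 mult_eq_0_iff)
    also have "\<dots> \<longleftrightarrow> cmod (\<beta> - of_real \<alpha> * z) = 1"
      by (simp only: abs_square_eq_1 abs_norm_cancel)
    also have "\<beta> - of_real \<alpha> * z = of_real \<alpha> * (\<beta> / of_real \<alpha> - z)"
      using \<alpha> by (simp add: field_simps)
    also have "cmod \<dots> = 1 \<longleftrightarrow> dist (\<beta> / of_real \<alpha>) z = 1 / \<bar>\<alpha>\<bar>"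
      unfolding norm_mult dist_norm using \<alpha> by (simp add: field_simps)
    finally show ?thesis .
  qed
  moreover have "None \<notin> zeros x"
    using \<alpha> by (simp add: None_in_zeros_iff x)
  ultimately show ?thesis
    unfolding x fst_conv snd_conv set_eq_iff using None_notin_ecircle Some_in_ecircle_iff Some_in_zeros_iff
    by (metis option.exhaust)
qed

text \<open>With leading coefficient 0, norm 1 makes \<open>\<beta>\<close> a unit normal and the
  equation becomes \<open>Re (cnj \<beta> * z) = \<delta> / 2\<close>.\<close>

lemma zeros_eq_eline:
  assumes "hpair x x = 1" "fst x = 0"
  shows "zeros x = eline (of_real (snd (snd x) / 2) * fst (snd x)) (\<i> * fst (snd x))"
proof -
  obtain \<beta> \<delta> where x: "x = (0, \<beta>, \<delta>)" using assms by (cases x) auto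
  have n: "\<beta> * cnj \<beta> = 1"
    using assms by (auto simp: x hpair_def complex_eq_iff)
  have "hval x (z, 1) = 0 \<longleftrightarrow> (\<exists>t. z = of_real (\<delta> / 2) * \<beta> + of_real t * (\<i> * \<beta>))" for z
  proof
    assume "hval x (z, 1) = 0"
    then have "Re (cnj \<beta> * z) = \<delta> / 2" by (simp add: x hval_def)
    then have "cnj \<beta> * z = of_real (\<delta> / 2) + of_real (Im (cnj \<beta> * z)) * \<i>"
      by (simp add: complex_eq_iff)
    then have "\<beta> * cnj \<beta> * z = \<beta> * (of_real (\<delta> / 2) + of_real (Im (cnj \<beta> * z)) * \<i>)"
      by (metis mult.assoc)
    then show "\<exists>t. z = of_real (\<delta> / 2) * \<beta> + of_real t * (\<i> * \<beta>)"
      unfolding n by (intro exI[of _ "Im (cnj \<beta> * z)"]) (simp add: algebra_simps)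
  next
    assume "\<exists>t. z = of_real (\<delta> / 2) * \<beta> + of_real t * (\<i> * \<beta>)"
    then obtain t where "z = of_real (\<delta> / 2) * \<beta> + of_real t * (\<i> * \<beta>)" by blast
    then have "cnj \<beta> * z = (\<beta> * cnj \<beta>) * (of_real (\<delta> / 2) + of_real t * \<i>)"
      by (simp add: algebra_simps)
    then show "hval x (z, 1) = 0" unfolding n by (simp add: x hval_def)
  qed
  moreover have "None \<in> zeros x"
    by (simp add: None_in_zeros_iff x)
  ultimately show ?thesis
    unfolding x fst_conv snd_conv set_eq_iff using None_in_eline Some_in_eline_iff Some_in_zeros_iff
    by (metis option.exhaust)
qed

text \<open>Absolute values absorb both the sign of the form and the sign convention for an
  enclosing circle, so \<open>P\<close> can be arbitrary.\<close>

lemma abs_curvature_zeros: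
  assumes "hpair x x = 1"
  shows "\<bar>curvature P (zeros x)\<bar> = \<bar>fst x\<bar>"
proof (cases "fst x = 0")
  case True
  have "fst (snd x) \<noteq> 0" using assms True by (auto simp: hpair_def)
  then show ?thesis
    using True by (simp add: zeros_eq_eline[OF assms True] curvature_eline)
next
  case False
  then show ?thesis
    by (simp add: zeros_eq_ecircle[OF assms False] curvature_ecircle)
qed

section \<open>Inversions as reflections of forms\<close>

definition hreflect :: "hform \<Rightarrow> hform \<Rightarrow> hform" where
  "hreflect d y = y - (2 * hpair y d) *\<^sub>R d"

text \<open>The inversion in the zero set of \<open>d\<close> in homogeneous coordinates, uniform for circles
  and lines: on \<open>d = (\<alpha>, \<beta>, \<delta>)\<close> it is \<open>z \<mapsto> (\<beta> cnj z - \<delta>) / (\<alpha> cnj z - cnj \<beta>)\<close>.\<close>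
definition hinv :: "hform \<Rightarrow> complex \<times> complex \<Rightarrow> complex \<times> complex" where
  "hinv d z = (fst (snd d) * cnj (fst z) - of_real (snd (snd d)) * cnj (snd z),
     of_real (fst d) * cnj (fst z) - cnj (fst (snd d)) * cnj (snd z))"

lemma hpair_add_left: "hpair (x + y) z = hpair x z + hpair y z"
  and hpair_add_right: "hpair z (x + y) = hpair z x + hpair z y"
  and hpair_scale_left: "hpair (r *\<^sub>R x) y = r * hpair x y"
  and hpair_scale_right: "hpair x (r *\<^sub>R y) = r * hpair x y"
  and hpair_commute: "hpair x y = hpair y x"
  and hpair_diff_left: "hpair (x - y) z = hpair x z - hpair y z"
  and hpair_diff_right: "hpair z (x - y) = hpair z x - hpair z y"
  by (auto simp: hpair_def algebra_simps add_divide_distrib diff_divide_distrib)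

lemma hpair_hreflect: "hpair d d = 1 \<Longrightarrow> hpair (hreflect d x) (hreflect d y) = hpair x y"
  unfolding hreflect_def
  by (simp add: hpair_diff_left hpair_diff_right hpair_scale_left hpair_scale_right hpair_commute)

text \<open>A polynomial identity in real coordinates. At norm 1 its right side is
  \<open>hval (hreflect d y) z\<close>: inverting the point amounts to reflecting the form.\<close>

lemma hval_hinv_general:
  "hval y (hinv d z) = hpair d d * hval y z - 2 * hpair y d * hval d z"
proof -
  obtain \<alpha> b1 b2 \<delta> where d: "d = (\<alpha>, Complex b1 b2, \<delta>)"
    by (metis complex.exhaust surj_pair)
  obtain \<alpha>' b1' b2' \<delta>' where y: "y = (\<alpha>', Complex b1' b2', \<delta>')"
    by (metis complex.exhaust surj_pair)
  obtain z1 z2 z3 z4 where z: "z = (Complex z1 z2, Complex z3 z4)"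
    by (metis complex.exhaust surj_pair)
  show ?thesis
    unfolding hval_def hinv_def hpair_def d y z cmod_power2
    by (simp add: power2_eq_square field_simps)
qed

lemma hval_hinv:
  assumes "hpair d d = 1"
  shows "hval (hreflect d y) (hinv d z) = hval y z"
proof -
  have lin: "hval (hreflect d y) w = hval y w - 2 * hpair y d * hval d w" for w
    by (simp add: hval_def hreflect_def algebra_simps)
  show ?thesis
    by (simp only: lin) (simp add: hval_hinv_general assms)
qed

text \<open>The matrix of \<open>hinv d\<close> times its complex conjugate is the norm of
  \<open>d\<close> times the identity.\<close>

lemma hinv_hinv:
  assumes "hpair d d = 1"
  shows "hinv d (hinv d z) = z"
proof -
  obtain \<alpha> \<beta> \<delta> where d: "d = (\<alpha>, \<beta>, \<delta>)" by (cases d) auto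
  have n: "\<beta> * cnj \<beta> - of_real \<alpha> * of_real \<delta> = 1"
    using assms by (auto simp: d hpair_def complex_eq_iff)
  have n': "\<beta> * (cnj \<beta> * w) = w + of_real \<alpha> * (of_real \<delta> * w)" for w
  proof -
    have "\<beta> * (cnj \<beta> * w) - of_real \<alpha> * (of_real \<delta> * w) = (\<beta> * cnj \<beta> - of_real \<alpha> * of_real \<delta>) * w"
      by (simp only: left_diff_distrib mult.assoc)
    then show ?thesis
      unfolding n by (simp add: algebra_simps)
  qed
  show ?thesis
    unfolding hinv_def d prod_eq_iff by (simp add: right_diff_distrib n' mult.left_commute)
qed

lemma hinv_0: "hinv d 0 = 0" by (simp add: hinv_def zero_prod_def)

lemma inversion_zeros:
  assumes "hpair d d = 1" "\<And>z. z \<noteq> 0 \<Longrightarrow> s (epoint z) = epoint (hinv d z)"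
  shows "s ` zeros y = zeros (hreflect d y)"
  by (rule image_zeros[where \<phi> = "hinv d" and \<psi> = "hinv d"])
    (auto simp: hinv_hinv hinv_0 hval_hinv assms)

lemma epoint_cases:
  fixes z :: "complex \<times> complex"
  assumes "z \<noteq> 0"
  obtains k where "k \<noteq> 0" "z = (k, 0)" | k w where "k \<noteq> 0" "z = (k * w, k)"
proof (cases "snd z = 0")
  case True then show ?thesis using assms that(1)[of "fst z"] by (cases z) (auto simp: prod_eq_iff)
next
  case False then show ?thesis using that(2)[of "snd z" "fst z / snd z"] by (cases z) (auto simp: prod_eq_iff)
qed

lemma epoint_scale: "k \<noteq> 0 \<Longrightarrow> epoint (k * z, k * w) = epoint (z, w)"
  by (auto simp: epoint_def)

lemma hinv_scale: "hinv d (k * z, k * w) = (cnj k * fst (hinv d (z, w)), cnj k * snd (hinv d (z, w)))"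
  by (simp add: hinv_def algebra_simps)

text \<open>The data \<open>c, r\<close> or \<open>p, v\<close> presenting the inversion are
  recovered from the coefficients of \<open>d\<close> as far as the map depends on them, so every
  element of \<open>inversions_in\<close> has the same lift.\<close>

lemma inversion_epoint:
  assumes d: "hpair d d = 1" and s: "s \<in> inversions_in (zeros d)" and z: "z \<noteq> 0"
  shows "s (epoint z) = epoint (hinv d z)"
proof -
  obtain \<alpha> \<beta> \<delta> where d_eq: "d = (\<alpha>, \<beta>, \<delta>)" by (cases d) auto
  have n: "\<beta> * cnj \<beta> = 1 + of_real \<alpha> * of_real \<delta>"
    using d by (auto simp: d_eq hpair_def complex_eq_iff)
  consider (circle) c r where "r > 0" "zeros d = ecircle c r" "s = circle_inversion c r"
    | (line) p v where "v \<noteq> 0" "zeros d = eline p v" "s = line_reflection p v"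
    using s unfolding inversions_in_def by blast
  then show ?thesis
  proof cases
    case circle
    have \<alpha>: "\<alpha> \<noteq> 0"
      using circle(2) zeros_eq_eline[OF d] ecircle_neq_eline unfolding d_eq fst_conv by metis
    have "ecircle c r = ecircle (\<beta> / of_real \<alpha>) (1 / \<bar>\<alpha>\<bar>)"
      using zeros_eq_ecircle[OF d] circle(2) \<alpha> by (simp add: d_eq)
    then have cr: "c = \<beta> / of_real \<alpha>" "r = 1 / \<bar>\<alpha>\<bar>"
      using ecircle_eq_iff[OF circle(1), of "1 / \<bar>\<alpha>\<bar>"] \<alpha> by auto
    have r2: "r\<^sup>2 = 1 / \<alpha>\<^sup>2"
      by (simp add: cr power_divide)
    from z show ?thesis
    proof (cases rule: epoint_cases)
      case (1 k)
      then show ?thesis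
        using \<alpha> by (simp add: circle(3) circle_inversion_def epoint_def hinv_def d_eq cr)
    next
      case (2 k w)
      have "circle_inversion c r (Some w) = epoint (hinv d (w, 1))"
      proof (cases "w = c")
        case True
        then have "cnj w * of_real \<alpha> = cnj \<beta>"
          using \<alpha> by (simp add: cr)
        then show ?thesis
          using True by (simp add: circle_inversion_def hinv_def d_eq epoint_def mult.commute)
      next
        case False
        have ne: "of_real \<alpha> * cnj w - cnj \<beta> \<noteq> 0"
        proof
          assume "of_real \<alpha> * cnj w - cnj \<beta> = 0"
          then have "cnj (of_real \<alpha> * w) = cnj \<beta>" by simp
          then have "of_real \<alpha> * w = \<beta>" by (metis complex_cnj_cancel_iff)
          then show False using False \<alpha> by (auto simp: cr)
        qed
        have cw: "cnj (w - c) = (of_real \<alpha> * cnj w - cnj \<beta>) / of_real \<alpha>"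
          using \<alpha> by (simp add: cr diff_divide_distrib)
        have "c + of_real (r\<^sup>2) / cnj (w - c)
            = \<beta> / of_real \<alpha> + 1 / (of_real \<alpha> * (of_real \<alpha> * cnj w - cnj \<beta>))"
          unfolding r2 cw using \<alpha> by (simp add: cr power2_eq_square)
        also have "\<dots> = (\<beta> * (of_real \<alpha> * cnj w - cnj \<beta>) + 1) / (of_real \<alpha> * (of_real \<alpha> * cnj w - cnj \<beta>))"
          using ne by (simp add: add_divide_distrib)
        also have "\<beta> * (of_real \<alpha> * cnj w - cnj \<beta>) + 1 = of_real \<alpha> * (\<beta> * cnj w - of_real \<delta>)"
          using n by (simp add: right_diff_distrib mult.left_commute)
        finally show ?thesis
          using False ne \<alpha> by (simp add: circle_inversion_def hinv_def d_eq epoint_def)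
      qed
      moreover have "hinv d z = (cnj k * fst (hinv d (w, 1)), cnj k * snd (hinv d (w, 1)))"
        using hinv_scale[of d k w 1] 2 by simp
      ultimately show ?thesis
        using 2 epoint_scale[of k w 1] epoint_scale[of "cnj k" "fst (hinv d (w, 1))" "snd (hinv d (w, 1))"]
        by (simp add: circle(3) epoint_def[of "(w, 1)"])
    qed
  next
    case line
    have \<alpha>: "\<alpha> = 0"
      using line(2) zeros_eq_ecircle[OF d] ecircle_neq_eline unfolding d_eq fst_conv by metis
    have \<beta>: "\<beta> \<noteq> 0"
      using n \<alpha> by auto
    \<comment> \<open>Evaluated at \<open>t = 0\<close> and \<open>t = 1\<close>, this puts
      \<open>p\<close> on the line and makes \<open>v\<close> orthogonal to the normal
      \<open>\<beta>\<close>; the reflection formula needs just these two facts.\<close>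
    have mem: "Re (cnj \<beta> * (p + of_real t * v)) = \<delta> / 2" for t
    proof -
      have "Some (p + of_real t * v) \<in> zeros d"
        unfolding line(2) Some_in_eline_iff by blast
      then show ?thesis
        by (simp add: Some_in_zeros_iff hval_def d_eq \<alpha>)
    qed
    have p: "p * cnj \<beta> + cnj p * \<beta> = of_real \<delta>"
      using mem[of 0] by (simp add: complex_eq_iff)
    have "Re (cnj \<beta> * v) = 0"
      using mem[of 0] mem[of 1] by (simp add: algebra_simps)
    then have v: "v * cnj \<beta> = - (cnj v * \<beta>)"
      by (simp add: complex_eq_iff)
    from z show ?thesis
    proof (cases rule: epoint_cases)
      case (1 k)
      then show ?thesis
        using \<alpha> by (simp add: line(3) line_reflection_def epoint_def hinv_def d_eq)
    next
      case (2 k w)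
      have "v / cnj v = - \<beta> / cnj \<beta>"
        using v line(1) \<beta> by (simp add: field_simps)
      then have "p + v * cnj ((w - p) / v) = p - \<beta> / cnj \<beta> * (cnj w - cnj p)"
        by (metis complex_cnj_diff complex_cnj_divide diff_conv_add_uminus minus_divide_left
            mult_minus_left times_divide_eq_left times_divide_eq_right)
      also have "\<dots> = (p * cnj \<beta> + cnj p * \<beta> - \<beta> * cnj w) / cnj \<beta>"
        using \<beta> by (simp add: field_simps)
      finally have "line_reflection p v (Some w) = epoint (hinv d (w, 1))"
        using \<beta> unfolding p by (simp add: line_reflection_def epoint_def hinv_def d_eq \<alpha> minus_divide_left[symmetric] diff_divide_distrib)
      moreover have "hinv d z = (cnj k * fst (hinv d (w, 1)), cnj k * snd (hinv d (w, 1)))"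
        using hinv_scale[of d k w 1] 2 by simp
      ultimately show ?thesis
        using 2 epoint_scale[of k w 1] epoint_scale[of "cnj k" "fst (hinv d (w, 1))" "snd (hinv d (w, 1))"]
        by (simp add: line(3) epoint_def[of "(w, 1)"])
    qed
  qed
qed

lemma image_inversion_zeros:
  assumes "hpair d d = 1" "s \<in> inversions_in (zeros d)"
  shows "s ` zeros y = zeros (hreflect d y)"
  using inversion_zeros[OF assms(1)] inversion_epoint[OF assms] by blast

lemma inversions_in_zeros_nonempty:
  assumes "hpair d d = 1"
  obtains s where "s \<in> inversions_in (zeros d)"
proof (cases "fst d = 0")
  case True
  have "fst (snd d) \<noteq> 0" using assms True by (auto simp: hpair_def)
  then have "\<i> * fst (snd d) \<noteq> 0"
    by simp
  then have "line_reflection (of_real (snd (snd d) / 2) * fst (snd d)) (\<i> * fst (snd d)) \<in> inversions_in (zeros d)"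
    unfolding inversions_in_def zeros_eq_eline[OF assms True]
    by blast
  then show ?thesis ..
next
  case False
  have "1 / \<bar>fst d\<bar> > 0" using False by simp
  then show ?thesis
    using that zeros_eq_ecircle[OF assms False] unfolding inversions_in_def by blast
qed

section \<open>Moebius maps as isometries of forms\<close>

text \<open>The form composed with the adjugate matrix, which for determinant 1 is the inverse; see
  \<open>hval_hmoeb\<close>.\<close>

definition hmoeb :: "complex \<Rightarrow> complex \<Rightarrow> complex \<Rightarrow> complex \<Rightarrow> hform \<Rightarrow> hform" where
  "hmoeb a b c d x =
     (fst x * (cmod d)\<^sup>2 + 2 * Re (cnj (fst (snd x)) * d * cnj c) + snd (snd x) * (cmod c)\<^sup>2,
      of_real (fst x) * b * cnj d + fst (snd x) * a * cnj d + cnj (fst (snd x)) * b * cnj c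
        + of_real (snd (snd x)) * a * cnj c,
      fst x * (cmod b)\<^sup>2 + 2 * Re (cnj (fst (snd x)) * b * cnj a) + snd (snd x) * (cmod a)\<^sup>2)"

lemma hmoeb_add: "hmoeb a b c d (x + y) = hmoeb a b c d x + hmoeb a b c d y"
  by (simp add: hmoeb_def prod_eq_iff algebra_simps)

lemma hmoeb_scaleR: "hmoeb a b c d (r *\<^sub>R x) = r *\<^sub>R hmoeb a b c d x"
  by (simp add: hmoeb_def prod_eq_iff algebra_simps scaleR_conv_of_real)

lemma of_real_cmod_power2: "complex_of_real ((cmod u)\<^sup>2) = u * cnj u"
  by (rule complex_norm_square)

lemma of_real_double_Re: "complex_of_real (2 * Re u) = u + cnj u"
  by (simp add: complex_add_cnj)

text \<open>With squared moduli and real parts written through conjugates, the later identities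
  become polynomial, a letter and its conjugate acting as independent variables.\<close>

lemma hmoeb_complex:
  "complex_of_real (fst (hmoeb a b c d (\<alpha>, \<beta>, \<delta>)))
     = of_real \<alpha> * (d * cnj d) + (cnj \<beta> * d * cnj c + \<beta> * cnj d * c) + of_real \<delta> * (c * cnj c)"
  "complex_of_real (snd (snd (hmoeb a b c d (\<alpha>, \<beta>, \<delta>))))
     = of_real \<alpha> * (b * cnj b) + (cnj \<beta> * b * cnj a + \<beta> * cnj b * a) + of_real \<delta> * (a * cnj a)"
  "fst (snd (hmoeb a b c d (\<alpha>, \<beta>, \<delta>)))
     = of_real \<alpha> * b * cnj d + \<beta> * a * cnj d + cnj \<beta> * b * cnj c + of_real \<delta> * a * cnj c"
  unfolding hmoeb_def fst_conv snd_conv of_real_add of_real_mult[of \<alpha>] of_real_mult[of \<delta>]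
    of_real_cmod_power2 of_real_double_Re
  by simp_all

lemma hval_complex:
  "complex_of_real (hval x (z, w)) = of_real (fst x) * (z * cnj z)
     - (cnj (fst (snd x)) * z * cnj w + fst (snd x) * cnj z * w) + of_real (snd (snd x)) * (w * cnj w)"
  unfolding hval_def fst_conv snd_conv of_real_add of_real_diff of_real_mult[of "fst x"]
    of_real_mult[of "snd (snd x)"] of_real_cmod_power2 of_real_double_Re
  by simp

lemma hpair_complex:
  "complex_of_real (2 * hpair x y) = fst (snd x) * cnj (fst (snd y)) + cnj (fst (snd x)) * fst (snd y)
     - (of_real (fst x) * of_real (snd (snd y)) + of_real (fst y) * of_real (snd (snd x)))"
proof -
  have "2 * hpair x y = 2 * Re (fst (snd x) * cnj (fst (snd y)))
      - (fst x * snd (snd y) + fst y * snd (snd x))"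
    by (simp add: hpair_def field_simps)
  then show ?thesis
    by (simp only: of_real_diff of_real_double_Re) simp
qed

lemma hval_hmoeb:
  "hval (hmoeb a b c d x) (z, w) = hval x (d * z - b * w, a * w - c * z)"
proof -
  obtain \<alpha> \<beta> \<delta> where x: "x = (\<alpha>, \<beta>, \<delta>)" by (cases x) auto
  have "complex_of_real (hval (hmoeb a b c d x) (z, w)) = of_real (hval x (d * z - b * w, a * w - c * z))"
    unfolding hval_complex x hmoeb_complex fst_conv snd_conv
    by (simp add: algebra_simps)
  then show ?thesis
    by (simp only: of_real_eq_iff)
qed

text \<open>The polarized multiplicativity of the determinant of a Hermitian matrix under
  congruence, with primed letters standing for conjugates.\<close>

lemma sl2_quadratic_identity:
  fixes a b c d a' b' c' d' :: "'a :: comm_ring_1"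
  shows "(\<alpha> * b * d' + \<beta> * a * d' + \<beta>' * b * c' + \<delta> * a * c')
         * (x * b' * d + y' * a' * d + y * b' * c + z * a' * c)
       + (\<alpha> * b' * d + \<beta>' * a' * d + \<beta> * b' * c + \<delta> * a' * c)
         * (x * b * d' + y * a * d' + y' * b * c' + z * a * c')
       - ((\<alpha> * (d * d') + (\<beta>' * d * c' + \<beta> * d' * c) + \<delta> * (c * c'))
          * (x * (b * b') + (y' * b * a' + y * b' * a) + z * (a * a'))
        + (x * (d * d') + (y' * d * c' + y * d' * c) + z * (c * c'))
          * (\<alpha> * (b * b') + (\<beta>' * b * a' + \<beta> * b' * a) + \<delta> * (a * a')))
     = (a * d - b * c) * (a' * d' - b' * c') * (\<beta> * y' + \<beta>' * y - (\<alpha> * z + x * \<delta>))"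
  by (simp add: algebra_simps)

lemma hpair_hmoeb:
  assumes "a * d - b * c = 1"
  shows "hpair (hmoeb a b c d x) (hmoeb a b c d y) = hpair x y"
proof -
  have c: "cnj a * cnj d - cnj b * cnj c = 1"
    using arg_cong[OF assms, of cnj] by simp
  obtain \<alpha> \<beta> \<delta> where x: "x = (\<alpha>, \<beta>, \<delta>)" by (cases x) auto
  obtain \<alpha>' \<beta>' \<delta>' where y: "y = (\<alpha>', \<beta>', \<delta>')" by (cases y) auto
  have "complex_of_real (2 * hpair (hmoeb a b c d x) (hmoeb a b c d y)) = of_real (2 * hpair x y)"
    unfolding hpair_complex x y hmoeb_complex fst_conv snd_conv complex_cnj_add complex_cnj_mult
      complex_cnj_cnj complex_cnj_complex_of_real sl2_quadratic_identity assms c mult_1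
    by (rule refl)
  then show ?thesis
    by (simp only: of_real_eq_iff)
qed

lemma emoebius_epoint:
  assumes "a * d - b * c = 1" "z \<noteq> 0"
  shows "emoebius a b c d (epoint z) = epoint (a * fst z + b * snd z, c * fst z + d * snd z)"
  using assms(2)
proof (cases rule: epoint_cases)
  case (1 k)
  then show ?thesis by (simp add: emoebius_def epoint_def)
next
  case (2 k w)
  have "(a * fst z + b * snd z, c * fst z + d * snd z) = (k * (a * w + b), k * (c * w + d))"
    by (simp add: 2 algebra_simps)
  then show ?thesis
    using 2 epoint_scale[of k "a * w + b" "c * w + d"]
    by (simp add: emoebius_def epoint_def moebius_def)
qed

lemma emoebius_zeros:
  assumes "a * d - b * c = 1"
  shows "emoebius a b c d ` zeros x = zeros (hmoeb a b c d x)"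
proof (rule image_zeros)
  let ?\<phi> = "\<lambda>z. (a * fst z + b * snd z, c * fst z + d * snd z)"
  let ?\<psi> = "\<lambda>z. (d * fst z - b * snd z, a * snd z - c * fst z)"
  show "emoebius a b c d (epoint z) = epoint (?\<phi> z)" if "z \<noteq> 0" for z
    using emoebius_epoint[OF assms that] .
  have 1: "a * (d * u) - b * (c * u) = u" for u
    using assms by (metis left_diff_distrib mult.assoc mult_1)
  show "?\<phi> (?\<psi> z) = z" for z
    using 1[of "fst z"] 1[of "snd z"] by (simp add: prod_eq_iff algebra_simps)
  show psi: "?\<psi> (?\<phi> z) = z" for z
    using 1[of "fst z"] 1[of "snd z"] by (simp add: prod_eq_iff algebra_simps)
  show "?\<phi> 0 = 0" by (simp add: prod_eq_iff)
  show "hval (hmoeb a b c d x) (?\<phi> z) = hval x z" for z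
    using psi[of z] by (simp add: hval_hmoeb)
qed

lemma emoebius_scale:
  assumes "k \<noteq> 0"
  shows "emoebius (k * a) (k * b) (k * c) (k * d) = emoebius a b c d"
proof
  fix p
  have "k * c * z + k * d = k * (c * z + d)" "k * a * z + k * b = k * (a * z + b)" for z
    by (simp_all add: algebra_simps)
  then show "emoebius (k * a) (k * b) (k * c) (k * d) p = emoebius a b c d p"
    using assms by (cases p) (simp_all add: emoebius_def moebius_def)
qed

lemma emoebius_normalize:
  assumes "a * d - b * c \<noteq> 0"
  obtains a' b' c' d' where "a' * d' - b' * c' = 1" "emoebius a b c d = emoebius a' b' c' d'"
proof
  \<comment> \<open>Scaling all four entries by \<open>k\<close> multiplies the determinant by the
    square of \<open>k\<close> and leaves the Moebius map unchanged.\<close>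
  define k where "k = 1 / csqrt (a * d - b * c)"
  have "k\<^sup>2 * (a * d - b * c) = 1"
    using assms by (simp add: k_def power_divide)
  then show "(k * a) * (k * d) - (k * b) * (k * c) = 1"
    by (simp add: power2_eq_square algebra_simps)
  have "k \<noteq> 0" using assms by (simp add: k_def)
  then show "emoebius a b c d = emoebius (k * a) (k * b) (k * c) (k * d)"
    by (simp add: emoebius_scale)
qed

section \<open>Tangency\<close>

text \<open>Yields distinctness in tangency: equal zero sets would meet in all their points, hence
  in more than one.\<close>

lemma zeros_not_singleton:
  assumes "hpair x x = 1"
  shows "zeros x \<noteq> {q}"
proof
  assume eq: "zeros x = {q}"
  show False
  proof (cases "fst x = 0")
    case True
    then obtain p v where "zeros x = eline p v"
      using zeros_eq_eline[OF assms] by blast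
    then have "None \<in> {q}" "Some (p + of_real 0 * v) \<in> {q}"
      unfolding eq[symmetric] using None_in_eline Some_in_eline_iff by blast+
    then show False by simp
  next
    case False
    define c r where "c = fst (snd x) / of_real (fst x)" and "r = 1 / \<bar>fst x\<bar>"
    have r: "r > 0" and "zeros x = ecircle c r"
      using False zeros_eq_ecircle[OF assms] by (auto simp: r_def c_def)
    then have "Some (c + of_real r) \<in> {q}" "Some (c - of_real r) \<in> {q}"
      unfolding eq[symmetric] by (simp_all add: Some_in_ecircle_iff dist_norm)
    then show False using r by auto
  qed
qed

text \<open>A null form is a circle of radius 0, that is, a single point, and being orthogonal to it
  means passing through that point. The point is at infinity exactly when the leading coefficient is
  0.\<close>

lemma zeros_null:
  assumes n: "hpair n n = 0" "n \<noteq> 0"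
  obtains q where "zeros n = {q}" "\<And>x. hpair x n = 0 \<Longrightarrow> q \<in> zeros x"
proof -
  obtain \<alpha> \<beta> \<delta> where n_eq: "n = (\<alpha>, \<beta>, \<delta>)" by (cases n) auto
  have sq: "(cmod \<beta>)\<^sup>2 = \<alpha> * \<delta>"
    using n(1) unfolding hpair_def n_eq cmod_power2 by (simp add: power2_eq_square)
  show ?thesis
  proof (cases "\<alpha> = 0")
    case True
    then have \<beta>: "\<beta> = 0" using sq by simp
    then have "\<delta> \<noteq> 0" using True n(2) by (auto simp: n_eq zero_prod_def)
    then have "p \<in> zeros n \<longleftrightarrow> p \<in> {None}" for p
      using True \<beta> by (cases p) (simp_all add: None_in_zeros_iff Some_in_zeros_iff n_eq hval_def)
    moreover have "None \<in> zeros x" if "hpair x n = 0" for x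
      using that True \<beta> \<open>\<delta> \<noteq> 0\<close> by (simp add: hpair_def n_eq None_in_zeros_iff)
    ultimately show ?thesis
      using that[of None] by blast
  next
    case False
    have "p \<in> zeros n \<longleftrightarrow> p \<in> {Some (\<beta> / of_real \<alpha>)}" for p
    proof (cases p)
      case None
      then show ?thesis using False by (simp add: None_in_zeros_iff n_eq)
    next
      case (Some z)
      have "\<alpha> * hval n (z, 1) = (cmod (of_real \<alpha> * z - \<beta>))\<^sup>2 - ((cmod \<beta>)\<^sup>2 - \<alpha> * \<delta>)"
        unfolding hval_def n_eq cmod_power2 by (simp add: power2_eq_square algebra_simps)
      also have "(cmod \<beta>)\<^sup>2 - \<alpha> * \<delta> = 0" using sq by simp
      finally have "hval n (z, 1) = 0 \<longleftrightarrow> of_real \<alpha> * z - \<beta> = 0"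
        using False by (metis diff_zero mult_eq_0_iff norm_eq_zero zero_eq_power2)
      also have "\<dots> \<longleftrightarrow> z = \<beta> / of_real \<alpha>"
        using False by (simp add: eq_divide_eq mult.commute)
      finally show ?thesis using Some by (simp add: Some_in_zeros_iff)
    qed
    moreover have "Some (\<beta> / of_real \<alpha>) \<in> zeros x" if "hpair x n = 0" for x
    proof -
      have "\<alpha>\<^sup>2 * hval x (\<beta> / of_real \<alpha>, 1) = hval x (\<beta>, of_real \<alpha>)"
        using hval_scale[of x "of_real \<alpha>" "\<beta> / of_real \<alpha>" 1] False by simp
      \<comment> \<open>At the coordinates \<open>(\<beta>, \<alpha>)\<close> of the point the null
        condition \<open>sq\<close> turns the value of any form into a multiple of its product with
        \<open>n\<close>.\<close>
      also have "\<dots> = - 2 * \<alpha> * hpair x n"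
        unfolding hval_def hpair_def n_eq fst_conv snd_conv sq
        by (simp add: power2_eq_square field_simps)
      finally show ?thesis using False that by (simp add: Some_in_zeros_iff)
    qed
    ultimately show ?thesis
      using that[of "Some (\<beta> / of_real \<alpha>)"] by blast
  qed
qed

text \<open>For forms of norm 1 with product \<open>-1\<close>, the sum is a nonzero null form, whose only zero is
  the point of tangency.\<close>
lemma tangent_zeros:
  assumes x: "hpair x x = 1" and y: "hpair y y = 1" and xy: "hpair x y = - 1" and ne: "x + y \<noteq> 0"
  shows "tangent (zeros x) (zeros y)"
proof -
  have 0: "hpair x (x + y) = 0" "hpair y (x + y) = 0"
    using x y xy by (simp_all add: hpair_add_right hpair_commute[of y x])
  then have "hpair (x + y) (x + y) = 0"
    by (simp only: hpair_add_left)
  then obtain q where q: "zeros (x + y) = {q}" "\<And>z. hpair z (x + y) = 0 \<Longrightarrow> q \<in> zeros z"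
    using zeros_null ne by blast
  have "zeros x \<inter> zeros y \<subseteq> zeros (x + y)"
  proof
    fix p assume p: "p \<in> zeros x \<inter> zeros y"
    then obtain z where z: "z \<noteq> 0" "p = epoint z"
      unfolding zeros_def by blast
    have "hval (x + y) z = hval x z + hval y z"
      by (simp add: hval_def algebra_simps)
    then show "p \<in> zeros (x + y)"
      using p z by (simp add: epoint_in_zeros_iff)
  qed
  then have "zeros x \<inter> zeros y = {q}"
    using q 0 by blast
  then show ?thesis
    unfolding tangent_def using zeros_not_singleton[OF x] by blast
qed

section \<open>The triangular grid\<close>

definition omega :: complex where
  "omega = Complex (1 / 2) (sqrt 3 / 2)"

definition lat :: "real \<Rightarrow> real \<Rightarrow> complex" where
  "lat x y = 2 * of_real x + 2 * of_real y * omega"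

text \<open>Coordinates in which the unit circle at the grid point \<open>2 m + 2 n omega\<close> is
  \<open>(1, m, n, m\<^sup>2 + m n + n\<^sup>2)\<close>.\<close>
definition evec :: "int \<times> int \<times> int \<times> int \<Rightarrow> hform" where
  "evec = (\<lambda>(v0, v1, v2, v3). (of_int v0, lat (of_int v1) (of_int v2), 4 * of_int v3 - of_int v0))"

definition gridvec :: "int \<Rightarrow> int \<Rightarrow> int \<times> int \<times> int \<times> int" where
  "gridvec m n = (1, m, n, m\<^sup>2 + m * n + n\<^sup>2)"

text \<open>For \<open>e = 1\<close> and \<open>e = -1\<close> these are the centroids of the triangles on the grid
  points \<open>(m, n), (m + e, n), (m, n + e)\<close>.\<close>
definition dual_center :: "int \<Rightarrow> int \<Rightarrow> int \<Rightarrow> complex" where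
  "dual_center e m n = lat (of_int m + of_int e / 3) (of_int n + of_int e / 3)"

text \<open>The factor is the curvature of a circle of radius \<open>1 / sqrt 3\<close> and brings
  the form to norm 1.\<close>

definition dual_form :: "int \<Rightarrow> int \<Rightarrow> int \<Rightarrow> hform" where
  "dual_form e m n = sqrt 3 *\<^sub>R (1, dual_center e m n, (cmod (dual_center e m n))\<^sup>2 - 1 / 3)"

text \<open>Half the product of \<open>evec v\<close> with the dual form divided by
  \<open>sqrt 3\<close>. Its integrality is what lets the reflections act on integer
  coordinates.\<close>

definition kappa :: "int \<Rightarrow> int \<Rightarrow> int \<Rightarrow> int \<times> int \<times> int \<times> int \<Rightarrow> int" where
  "kappa e m n = (\<lambda>(v0, v1, v2, v3). (2 * m + n + e) * v1 + (m + 2 * n + e) * v2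
     - (m\<^sup>2 + m * n + n\<^sup>2 + e * (m + n)) * v0 - v3)"

definition triref :: "int \<Rightarrow> int \<Rightarrow> int \<Rightarrow> int \<times> int \<times> int \<times> int \<Rightarrow> int \<times> int \<times> int \<times> int" where
  "triref e m n v = (case v of (v0, v1, v2, v3) \<Rightarrow>
     (v0 - 12 * kappa e m n v, v1 - 2 * kappa e m n v * (6 * m + 2 * e),
      v2 - 2 * kappa e m n v * (6 * n + 2 * e),
      v3 - 2 * kappa e m n v * (6 * (m\<^sup>2 + m * n + n\<^sup>2 + e * (m + n)) + 3)))"

lemma exp_pi_third: "exp (\<i> * of_real (pi / 3)) = omega"
  using cis_conv_exp[of "pi / 3"] by (simp add: omega_def complex_eq_iff cos_60 sin_60)

lemma grid_centers_eq: "grid_centers = {lat (of_int m) (of_int n) | m n. True}"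
  unfolding grid_centers_def exp_pi_third by (simp add: lat_def)

lemma Re_lat_cnj_lat: "Re (lat x y * cnj (lat z w)) = 4 * (x * z + y * w) + 2 * (x * w + y * z)"
  by (simp add: lat_def omega_def algebra_simps)

lemma cmod_lat: "(cmod (lat x y))\<^sup>2 = 4 * (x\<^sup>2 + x * y + y\<^sup>2)"
proof -
  have "(cmod (lat x y))\<^sup>2 = Re (lat x y * cnj (lat x y))"
    unfolding cmod_power2 by (simp add: power2_eq_square)
  then show ?thesis
    unfolding Re_lat_cnj_lat by (simp add: power2_eq_square algebra_simps)
qed

lemma hpair_evec_gridvec: "hpair (evec (gridvec m n)) (evec (gridvec m n)) = 1"
  unfolding hpair_def evec_def gridvec_def
  by (simp add: Re_lat_cnj_lat power2_eq_square field_simps del: times_complex.sel complex_cnj)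

lemma zeros_evec_gridvec: "zeros (evec (gridvec m n)) = ecircle (lat (of_int m) (of_int n)) 1"
  using zeros_eq_ecircle[OF hpair_evec_gridvec[of m n]] by (simp add: evec_def gridvec_def)

lemma grid_circles_eq: "grid_circles = {zeros (evec (gridvec m n)) | m n. True}"
  unfolding grid_circles_def grid_centers_eq zeros_evec_gridvec by blast

section \<open>Reflections in the dual circles in integer coordinates\<close>

lemma sqrt_3_mult: "sqrt 3 * (sqrt 3 * x) = 3 * x"
  by (simp flip: mult.assoc)

lemma hpair_dual_form: "hpair (dual_form e m n) (dual_form e m n) = 1"
proof -
  have "hpair (1, t, (cmod t)\<^sup>2 - 1 / 3) (1, t, (cmod t)\<^sup>2 - 1 / 3) = 1 / 3" for t
    unfolding hpair_def cmod_power2 by (simp add: power2_eq_square field_simps)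
  then show ?thesis
    unfolding dual_form_def hpair_scale_left hpair_scale_right sqrt_3_mult
    by (simp only:)
qed

lemma zeros_dual_form: "zeros (dual_form e m n) = ecircle (dual_center e m n) (1 / sqrt 3)"
  using zeros_eq_ecircle[OF hpair_dual_form[of e m n]]
  by (simp add: dual_form_def scaleR_conv_of_real)

lemma evec_triref:
  assumes "e\<^sup>2 = 1"
  shows "evec (triref e m n v) = hreflect (dual_form e m n) (evec v)"
proof -
  obtain v0 v1 v2 v3 where v: "v = (v0, v1, v2, v3)" by (cases v) auto
  define t where "t = dual_center e m n"
  have e: "(of_int e)\<^sup>2 = (1::real)"
    using assms by (metis of_int_1 of_int_power)
  define N where "N = m\<^sup>2 + m * n + n\<^sup>2 + e * (m + n)"
  \<comment> \<open>By \<open>e\<close> squared being 1 the centroid has squared modulus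
    \<open>4 N + 4 / 3\<close>, so the last entry is an integer.\<close>
  have t: "(cmod t)\<^sup>2 - 1 / 3 = 4 * of_int N + 1"
    unfolding t_def dual_center_def cmod_lat N_def using e
    by (simp add: power2_eq_square field_simps)
  have hp: "hpair (evec v) (1, t, (cmod t)\<^sup>2 - 1 / 3) = 2 * of_int (kappa e m n v)"
    unfolding t unfolding t_def dual_center_def hpair_def evec_def v prod.case fst_conv snd_conv Re_lat_cnj_lat
      kappa_def N_def
    by (simp add: field_simps)
  have "hreflect (dual_form e m n) (evec v)
      = evec v - (12 * of_int (kappa e m n v)) *\<^sub>R (1, t, (cmod t)\<^sup>2 - 1 / 3)"
    unfolding hreflect_def dual_form_def t_def[symmetric] hpair_scale_right hp scaleR_scaleR
    by (simp add: sqrt_3_mult mult.left_commute mult.commute)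
  also have "\<dots> = evec (triref e m n v)"
    unfolding t unfolding triref_def v prod.case evec_def prod_eq_iff t_def dual_center_def N_def
    by (simp add: lat_def scaleR_conv_of_real algebra_simps)
  finally show ?thesis ..
qed

text \<open>The half turn about the midpoint of the centers swaps the circles, so a unique common
  point must be the midpoint. Conversely, at distance 2 the parallelogram law forces every common
  point to the midpoint.\<close>

lemma tangent_unit_circles_iff: "tangent (ecircle u 1) (ecircle v 1) \<longleftrightarrow> cmod (u - v) = 2"
proof
  assume t: "tangent (ecircle u 1) (ecircle v 1)"
  then obtain q where q: "ecircle u 1 \<inter> ecircle v 1 = {q}" and ne: "u \<noteq> v"
    unfolding tangent_def by auto
  then obtain z where z: "q = Some z" using None_notin_ecircle by (cases q) auto
  have "Some z \<in> ecircle u 1 \<inter> ecircle v 1" using q z by simp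
  then have d: "dist u z = 1" "dist v z = 1" by (auto simp: Some_in_ecircle_iff)
  have "Some (u + v - z) \<in> ecircle u 1 \<inter> ecircle v 1"
    using d by (simp add: Some_in_ecircle_iff dist_norm norm_minus_commute algebra_simps)
  then have "u + v - z = z" using q z by simp
  then have "u - v = 2 * (u - z)" by (simp add: algebra_simps)
  then have "cmod (u - v) = 2 * dist u z" by (simp only: norm_mult dist_norm) simp
  then show "cmod (u - v) = 2" using d by simp
next
  assume d: "cmod (u - v) = 2"
  have "q \<in> ecircle u 1 \<inter> ecircle v 1 \<longleftrightarrow> q \<in> {Some ((u + v) / 2)}" for q
  proof (cases q)
    case None
    then show ?thesis by (simp add: None_notin_ecircle)
  next
    case (Some z)
    have par: "(cmod (2 * z - (u + v)))\<^sup>2 + (cmod (u - v))\<^sup>2 = 2 * (cmod (u - z))\<^sup>2 + 2 * (cmod (v - z))\<^sup>2"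
      unfolding cmod_power2 by (simp add: power2_eq_square algebra_simps)
    have "z = (u + v) / 2" if "cmod (u - z) = 1" "cmod (v - z) = 1"
      using par that d by (simp add: field_simps)
    moreover have "cmod (u - (u + v) / 2) = 1" "cmod (v - (u + v) / 2) = 1"
    proof -
      have "u - (u + v) / 2 = (u - v) / 2" "v - (u + v) / 2 = - ((u - v) / 2)"
        by (simp_all add: field_simps)
      then show "cmod (u - (u + v) / 2) = 1" "cmod (v - (u + v) / 2) = 1"
        using d by (simp_all only: norm_minus_cancel norm_divide) simp_all
    qed
    ultimately have "cmod (u - z) = 1 \<and> cmod (v - z) = 1 \<longleftrightarrow> z = (u + v) / 2"
      by blast
    then show ?thesis
      by (simp only: Some Int_iff Some_in_ecircle_iff dist_norm singleton_iff option.inject)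
  qed
  then have "ecircle u 1 \<inter> ecircle v 1 = {Some ((u + v) / 2)}" by blast
  moreover have "u \<noteq> v" using d by auto
  ultimately show "tangent (ecircle u 1) (ecircle v 1)"
    unfolding tangent_def by (simp add: ecircle_eq_iff)
qed

section \<open>Triangles of neighbouring grid points and the dual circles\<close>

lemma lat_diff: "lat x y - lat z w = lat (x - z) (y - w)"
  by (simp add: lat_def algebra_simps)

lemma tangent_lat_iff:
  "tangent (ecircle (lat (of_int m) (of_int n)) 1) (ecircle (lat (of_int k) (of_int l)) 1)
     \<longleftrightarrow> (m - k)\<^sup>2 + (m - k) * (n - l) + (n - l)\<^sup>2 = 1"
proof -
  have sq: "cmod z = 2 \<longleftrightarrow> (cmod z)\<^sup>2 = 4" for z
    using power2_eq_iff_nonneg[of "cmod z" 2] by simp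
  have "tangent (ecircle (lat (of_int m) (of_int n)) 1) (ecircle (lat (of_int k) (of_int l)) 1)
     \<longleftrightarrow> of_int ((m - k)\<^sup>2 + (m - k) * (n - l) + (n - l)\<^sup>2) = (1::real)"
    unfolding tangent_unit_circles_iff lat_diff sq cmod_lat by (simp del: distrib_left_numeral)
  then show ?thesis
    by (simp only: of_int_eq_1_iff)
qed

lemma eisenstein_norm_one:
  fixes x y :: int
  assumes "x\<^sup>2 + x * y + y\<^sup>2 = 1"
  shows "(x, y) \<in> {(1, 0), (-1, 0), (0, 1), (0, -1), (1, -1), (-1, 1)}"
proof -
  have "(2 * x + y)\<^sup>2 + 3 * y\<^sup>2 = 4" "(2 * y + x)\<^sup>2 + 3 * x\<^sup>2 = 4"
    using assms by (simp_all add: power2_eq_square algebra_simps)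
  then have "3 * y\<^sup>2 \<le> 4" "3 * x\<^sup>2 \<le> 4"
    by (smt (verit) zero_le_power2)+
  then have "x\<^sup>2 < 2\<^sup>2" "y\<^sup>2 < 2\<^sup>2" by simp_all
  then have "\<bar>x\<bar> < 2" "\<bar>y\<bar> < 2"
    using abs_le_square_iff[of 2 x] abs_le_square_iff[of 2 y] by linarith+
  then have "x \<in> {-1, 0, 1}" "y \<in> {-1, 0, 1}" by auto
  then show ?thesis using assms by auto
qed

text \<open>For consecutive edges \<open>(a, b)\<close> and \<open>(c, d)\<close> of a triangle, the
  vertex sum is three times the middle vertex plus their difference. Running through the six unit
  vectors, that difference is \<open>(1, 1)\<close> or \<open>(-1, -1)\<close> modulo 3, one residue
  for each orientation of the triangle.\<close>

lemma hexagon_difference: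
  fixes a b c d :: int
  assumes "a\<^sup>2 + a * b + b\<^sup>2 = 1" "c\<^sup>2 + c * d + d\<^sup>2 = 1"
    "(a + c)\<^sup>2 + (a + c) * (b + d) + (b + d)\<^sup>2 = 1"
  shows "\<exists>e m n. e\<^sup>2 = 1 \<and> a - c = 3 * m + e \<and> b - d = 3 * n + e"
proof -
  have "(a - c) mod 3 = 1 \<and> (b - d) mod 3 = 1 \<or> (a - c) mod 3 = 2 \<and> (b - d) mod 3 = 2"
    using eisenstein_norm_one[OF assms(1)] eisenstein_norm_one[OF assms(2)] assms(3) by auto
  then show ?thesis
  proof
    assume "(a - c) mod 3 = 1 \<and> (b - d) mod 3 = 1"
    then have "a - c = 3 * ((a - c) div 3) + 1" "b - d = 3 * ((b - d) div 3) + 1"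
      by presburger+
    moreover have "1\<^sup>2 = (1::int)" by simp
    ultimately show ?thesis by blast
  next
    assume "(a - c) mod 3 = 2 \<and> (b - d) mod 3 = 2"
    then have "a - c = 3 * ((a - c) div 3 + 1) + - 1" "b - d = 3 * ((b - d) div 3 + 1) + - 1"
      by presburger+
    moreover have "(- 1)\<^sup>2 = (1::int)" by simp
    ultimately show ?thesis by blast
  qed
qed

lemma grid_dual_circles_eq:
  "grid_dual_circles = {zeros (dual_form e m n) | e m n. e\<^sup>2 = 1}"
proof (intro equalityI subsetI)
  fix D assume "D \<in> grid_dual_circles"
  then obtain m1 n1 m2 n2 m3 n3 where
    D: "D = ecircle ((lat (of_int m1) (of_int n1) + lat (of_int m2) (of_int n2) + lat (of_int m3) (of_int n3)) / 3) (1 / sqrt 3)"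
    and t: "(m1 - m2)\<^sup>2 + (m1 - m2) * (n1 - n2) + (n1 - n2)\<^sup>2 = 1"
      "(m2 - m3)\<^sup>2 + (m2 - m3) * (n2 - n3) + (n2 - n3)\<^sup>2 = 1"
      "(m3 - m1)\<^sup>2 + (m3 - m1) * (n3 - n1) + (n3 - n1)\<^sup>2 = 1"
    unfolding grid_dual_circles_def grid_centers_eq by (auto simp: tangent_lat_iff)
  have "\<exists>e m n. e\<^sup>2 = 1 \<and> m1 + m2 + m3 = 3 * m + e \<and> n1 + n2 + n3 = 3 * n + e"
  proof -
    define a b c d where "a = m1 - m2" and "b = n1 - n2" and "c = m2 - m3" and "d = n2 - n3"
    then have ab: "m1 = m2 + a" "n1 = n2 + b" and cd: "m3 = m2 - c" "n3 = n2 - d" by simp_all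
    have "\<exists>e m n. e\<^sup>2 = 1 \<and> a - c = 3 * m + e \<and> b - d = 3 * n + e"
      by (rule hexagon_difference)
        (use t in \<open>simp_all only: ab cd\<close>, simp_all add: power2_eq_square algebra_simps)
    then obtain e m n where "e\<^sup>2 = 1" "a - c = 3 * m + e" "b - d = 3 * n + e" by blast
    then have "e\<^sup>2 = 1 \<and> m1 + m2 + m3 = 3 * (m2 + m) + e \<and> n1 + n2 + n3 = 3 * (n2 + n) + e"
      by (simp add: ab cd)
    then show ?thesis by blast
  qed
  then obtain e m n where e: "e\<^sup>2 = 1" "m1 + m2 + m3 = 3 * m + e" "n1 + n2 + n3 = 3 * n + e"
    by blast
  have s: "(of_int m1 + of_int m2 + of_int m3) / 3 = (of_int m + of_int e / 3 :: real)"
    "(of_int n1 + of_int n2 + of_int n3) / 3 = (of_int n + of_int e / 3 :: real)"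
    using arg_cong[OF e(2), of "of_int :: _ \<Rightarrow> real"] arg_cong[OF e(3), of "of_int :: _ \<Rightarrow> real"] by simp_all
  have "(lat (of_int m1) (of_int n1) + lat (of_int m2) (of_int n2) + lat (of_int m3) (of_int n3)) / 3
      = lat ((of_int m1 + of_int m2 + of_int m3) / 3) ((of_int n1 + of_int n2 + of_int n3) / 3)"
    by (simp add: lat_def field_simps)
  then have "D = zeros (dual_form e m n)"
    unfolding D zeros_dual_form dual_center_def s by simp
  then show "D \<in> {zeros (dual_form e m n) | e m n. e\<^sup>2 = 1}"
    using e(1) by blast
next
  fix D assume "D \<in> {zeros (dual_form e m n) | e m n. e\<^sup>2 = 1}"
  then obtain e m n where e: "e\<^sup>2 = 1" and D: "D = ecircle (dual_center e m n) (1 / sqrt 3)"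
    unfolding zeros_dual_form by blast
  define u v w where "u = lat (of_int m) (of_int n)" and "v = lat (of_int (m + e)) (of_int n)"
    and "w = lat (of_int m) (of_int (n + e))"
  have center: "dual_center e m n = (u + v + w) / 3"
    unfolding dual_center_def u_def v_def w_def by (simp add: lat_def field_simps)
  have "u \<in> grid_centers" "v \<in> grid_centers" "w \<in> grid_centers"
    unfolding grid_centers_eq u_def v_def w_def by blast+
  moreover have "tangent (ecircle u 1) (ecircle v 1)" "tangent (ecircle v 1) (ecircle w 1)"
    "tangent (ecircle w 1) (ecircle u 1)"
    unfolding u_def v_def w_def tangent_lat_iff using e by (simp_all add: power2_eq_square)
  ultimately have "ecircle ((u + v + w) / 3) (1 / sqrt 3) \<in> grid_dual_circles"
    unfolding grid_dual_circles_def by blast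
  then show "D \<in> grid_dual_circles"
    by (simp only: D center)
qed

section \<open>The orbit of the grid\<close>

text \<open>Kept in integer coordinates before any Moebius map is applied, so one set describes all
  packings.\<close>

inductive_set orbit :: "(int \<times> int \<times> int \<times> int) set" where
  gridvec: "gridvec m n \<in> orbit"
| triref: "v \<in> orbit \<Longrightarrow> e\<^sup>2 = 1 \<Longrightarrow> triref e m n v \<in> orbit"

lemma hpair_evec_orbit: "v \<in> orbit \<Longrightarrow> hpair (evec v) (evec v) = 1"
  by (induction rule: orbit.induct)
    (simp_all add: hpair_evec_gridvec evec_triref hpair_hreflect hpair_dual_form)

lemma hmoeb_hreflect:
  assumes "a * d - b * c = 1"
  shows "hmoeb a b c d (hreflect u x) = hreflect (hmoeb a b c d u) (hmoeb a b c d x)"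
proof -
  have "hmoeb a b c d (x - r *\<^sub>R u) = hmoeb a b c d x - r *\<^sub>R hmoeb a b c d u" for r
    using hmoeb_add[of a b c d x "(- r) *\<^sub>R u"] hmoeb_scaleR[of a b c d "- r" u] by simp
  then show ?thesis
    unfolding hreflect_def hpair_hmoeb[OF assms] .
qed

text \<open>The isometry \<open>L\<close> conjugates \<open>triref\<close> into the reflection in
  the transformed dual form, which is the action of the inversion on circles. Induction along group
  words gives one inclusion; induction along \<open>orbit\<close>, choosing an inversion at each
  step, gives the other.\<close>

lemma triangular_packing_eq:
  assumes "triangular_packing P"
  obtains a b c d where "a * d - b * c = 1"
    "P = {zeros (hmoeb a b c d (evec v)) | v. v \<in> orbit}"
proof -
  from assms obtain a0 b0 c0 d0 where "a0 * d0 - b0 * c0 \<noteq> 0" and P0: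
    "P = {g ` (emoebius a0 b0 c0 d0 ` C) | g C.
            g \<in> triangular_apollonian_group (emoebius a0 b0 c0 d0) \<and> C \<in> grid_circles}"
    unfolding triangular_packing_def by blast
  then obtain a b c d where det: "a * d - b * c = 1" and M: "emoebius a0 b0 c0 d0 = emoebius a b c d"
    using emoebius_normalize by metis
  define L where "L = hmoeb a b c d"
  note im = emoebius_zeros[OF det, folded L_def]
  let ?D = "{zeros (L (dual_form e m n)) | e m n. e\<^sup>2 = 1}"
  have group: "triangular_apollonian_group (emoebius a b c d) = inversion_group ?D"
    unfolding triangular_apollonian_group_def grid_dual_circles_eq
    unfolding im[symmetric] by (rule arg_cong[where f = inversion_group]) blast
  define G where "G = inversion_group ?D"
  have P: "P = {g ` zeros (L (evec (gridvec m n))) | g m n. g \<in> inversion_group ?D}"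
    unfolding P0 M group grid_circles_eq im[symmetric] unfolding G_def[unfolded im[symmetric], symmetric]
    by blast
  have norm: "hpair (L (dual_form e m n)) (L (dual_form e m n)) = 1" for e m n
    by (simp add: L_def hpair_hmoeb[OF det] hpair_dual_form)
  have inv_step: "s ` zeros (L (evec v)) = zeros (L (evec (triref e m n v)))"
    if "e\<^sup>2 = 1" "s \<in> inversions_in (zeros (L (dual_form e m n)))" for s e m n v
    unfolding image_inversion_zeros[OF norm that(2)] evec_triref[OF that(1)]
    by (simp add: L_def hmoeb_hreflect[OF det])
  have 1: "\<exists>w \<in> orbit. g ` zeros (L (evec v)) = zeros (L (evec w))"
    if "g \<in> inversion_group ?D" "v \<in> orbit" for g v
    using that(1)
  proof induction
    case id
    then show ?case using that(2) by auto
  next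
    case (step g D s)
    then obtain w e m n where w: "w \<in> orbit" "g ` zeros (L (evec v)) = zeros (L (evec w))"
      and "e\<^sup>2 = 1" "D = zeros (L (dual_form e m n))" by blast
    then have "(s \<circ> g) ` zeros (L (evec v)) = zeros (L (evec (triref e m n w)))"
      using inv_step[of e s m n w] step.hyps unfolding image_comp[symmetric] by simp
    then show ?case
      using w(1) \<open>e\<^sup>2 = 1\<close> orbit.triref by blast
  qed
  have 2: "\<exists>g \<in> inversion_group ?D. \<exists>m n. zeros (L (evec v)) = g ` zeros (L (evec (gridvec m n)))"
    if "v \<in> orbit" for v
    using that
  proof induction
    case (gridvec m n)
    then show ?case by (intro bexI[of _ id] exI) (auto intro: inversion_group.id)
  next
    case (triref v e m n)
    then obtain g k l where g: "g \<in> inversion_group ?D"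
      "zeros (L (evec v)) = g ` zeros (L (evec (gridvec k l)))" by blast
    obtain s where s: "s \<in> inversions_in (zeros (L (dual_form e m n)))"
      using inversions_in_zeros_nonempty[OF norm] by blast
    have "s \<circ> g \<in> inversion_group ?D"
      by (rule inversion_group.step[OF g(1) _ s]) (use triref in blast)
    moreover have "zeros (L (evec (triref e m n v))) = (s \<circ> g) ` zeros (L (evec (gridvec k l)))"
      using inv_step[OF triref(2) s] unfolding image_comp[symmetric] g(2)[symmetric] by simp
    ultimately show ?case by blast
  qed
  have "P = {zeros (L (evec v)) | v. v \<in> orbit}"
  proof (intro equalityI subsetI)
    fix C assume "C \<in> P"
    then obtain g m n where "g \<in> inversion_group ?D" "C = g ` zeros (L (evec (gridvec m n)))"
      unfolding P by blast
    then show "C \<in> {zeros (L (evec v)) | v. v \<in> orbit}"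
      using 1[OF _ orbit.gridvec] by blast
  next
    fix C assume "C \<in> {zeros (L (evec v)) | v. v \<in> orbit}"
    then show "C \<in> P"
      unfolding P using 2 by blast
  qed
  then show ?thesis
    unfolding L_def by (rule that[OF det])
qed

section \<open>Tangent circles with coprime curvatures\<close>

text \<open>Two of the six neighbours of each grid circle serve as seeds; the reflections carry them
  to further tangent circles.\<close>

inductive_set tangent_pairs ::
    "((int \<times> int \<times> int \<times> int) \<times> (int \<times> int \<times> int \<times> int)) set" where
  right: "(gridvec m n, gridvec (m + 1) n) \<in> tangent_pairs"
| up: "(gridvec m n, gridvec m (n + 1)) \<in> tangent_pairs"
| triref: "(v, w) \<in> tangent_pairs \<Longrightarrow> e\<^sup>2 = 1 \<Longrightarrow> (triref e m n v, triref e m n w) \<in> tangent_pairs"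

lemma hreflect_add: "hreflect d (x + y) = hreflect d x + hreflect d y"
  by (simp add: hreflect_def hpair_add_left algebra_simps)

lemma hreflect_eq_0D:
  assumes "hpair d d = 1" "hreflect d x = 0"
  shows "x = 0"
proof -
  have x: "x = (2 * hpair x d) *\<^sub>R d"
    using assms(2) by (simp add: hreflect_def)
  then have "hpair x d = 2 * hpair x d"
    using assms(1) hpair_scale_left by (metis mult.right_neutral)
  then show ?thesis using x by simp
qed

lemma tangent_pairsD:
  assumes "(v, w) \<in> tangent_pairs"
  shows "v \<in> orbit" "w \<in> orbit" "hpair (evec v) (evec w) = - 1" "evec v + evec w \<noteq> 0"
proof -
  have "v \<in> orbit \<and> w \<in> orbit \<and> hpair (evec v) (evec w) = - 1 \<and> evec v + evec w \<noteq> 0"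
    using assms
  proof induction
    case (right m n)
    have "hpair (evec (gridvec m n)) (evec (gridvec (m + 1) n)) = - 1"
      unfolding hpair_def evec_def gridvec_def prod.case fst_conv snd_conv Re_lat_cnj_lat
      by (simp add: power2_eq_square field_simps)
    then show ?case
      by (simp add: orbit.gridvec) (simp add: evec_def gridvec_def prod_eq_iff)
  next
    case (up m n)
    have "hpair (evec (gridvec m n)) (evec (gridvec m (n + 1))) = - 1"
      unfolding hpair_def evec_def gridvec_def prod.case fst_conv snd_conv Re_lat_cnj_lat
      by (simp add: power2_eq_square field_simps)
    then show ?case
      by (simp add: orbit.gridvec) (simp add: evec_def gridvec_def prod_eq_iff)
  next
    case (triref v w e m n)
    then show ?case
      using hreflect_eq_0D[OF hpair_dual_form[of e m n], of "evec v + evec w"]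
      by (auto simp: evec_triref hpair_hreflect hpair_dual_form orbit.triref hreflect_add)
  qed
  then show "v \<in> orbit" "w \<in> orbit" "hpair (evec v) (evec w) = - 1" "evec v + evec w \<noteq> 0"
    by blast+
qed

text \<open>By isometry \<open>x\<close> is orthogonal to every form, and the product is
  nondegenerate.\<close>

lemma hmoeb_eq_0D:
  assumes "a * d - b * c = 1" "hmoeb a b c d x = 0"
  shows "x = 0"
proof -
  have "hpair x y = 0" for y
    using hpair_hmoeb[OF assms(1), of x y] assms(2) by (simp add: hpair_def)
  from this[of "(0, 0, 1)"] this[of "(1, 0, 0)"] this[of "(0, 1, 0)"] this[of "(0, \<i>, 0)"]
  show ?thesis
    by (simp add: hpair_def prod_eq_iff complex_eq_iff)
qed

lemma tangent_zeros_hmoeb: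
  assumes "a * d - b * c = 1" "(v, w) \<in> tangent_pairs"
  shows "tangent (zeros (hmoeb a b c d (evec v))) (zeros (hmoeb a b c d (evec w)))"
proof (rule tangent_zeros)
  show "hmoeb a b c d (evec v) + hmoeb a b c d (evec w) \<noteq> 0"
    unfolding hmoeb_add[symmetric] using tangent_pairsD(4)[OF assms(2)] hmoeb_eq_0D[OF assms(1)] by blast
qed (simp_all add: hpair_hmoeb[OF assms(1)] hpair_evec_orbit tangent_pairsD[OF assms(2)])

section \<open>Additive functionals, parabolic chains and coprime values\<close>

definition smul :: "int \<Rightarrow> int \<times> int \<times> int \<times> int \<Rightarrow> int \<times> int \<times> int \<times> int" where
  "smul k = (\<lambda>(a, b, c, d). (k * a, k * b, k * c, k * d))"

lemma smul_1 [simp]: "smul 1 v = v"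
  by (cases v) (simp add: smul_def)

lemma smul_0 [simp]: "smul 0 v = 0"
  by (cases v) (simp add: smul_def zero_prod_def)

lemma smul_add_left: "smul (j + k) v = smul j v + smul k v"
  by (cases v) (simp add: smul_def distrib_right)

lemma additive_smul:
  assumes add: "\<And>v w. l (v + w) = (l v + l w :: int)"
  shows "l (smul k v) = k * l v"
proof -
  have zero: "l (smul 0 v) = 0"
    using add[of "smul 0 v" "smul 0 v"] smul_add_left[of 0 0 v] by simp
  have suc: "l (smul (k + 1) v) = l (smul k v) + l v" for k
    using add smul_add_left[of k 1 v] by simp
  show ?thesis
  proof (induction k rule: int_induct[where k = 0])
    case base then show ?case using zero by simp
  next
    case (step1 i) then show ?case by (simp add: suc distrib_right)
  next
    case (step2 i) then show ?case using suc[of "i - 1"] by (simp add: left_diff_distrib)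
  qed
qed

lemma additive_diff:
  fixes l :: "'a :: ab_group_add \<Rightarrow> int"
  assumes add: "\<And>v w. l (v + w) = l v + l w"
  shows "l (v - w) = l v - l w"
  using add[of "v - w" w] by simp

lemma triref_add: "triref e m n (v + w) = triref e m n v + triref e m n w"
  by (cases v; cases w) (simp add: triref_def kappa_def algebra_simps)

lemma triref_diff: "triref e m n (v - w) = triref e m n v - triref e m n w"
  using triref_add[of e m n "v - w" w] by (simp add: algebra_simps)

lemma triref_smul: "triref e m n (smul k v) = smul k (triref e m n v)"
  by (cases v) (simp add: triref_def kappa_def smul_def algebra_simps)

text \<open>A reflection negates the product with its own root; the factor
  \<open>8 * e\<^sup>2 - 6\<close> equals 2.\<close>

lemma kappa_triref:
  assumes "e\<^sup>2 = 1"
  shows "kappa e m n (triref e m n v) = - kappa e m n v"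
proof -
  obtain v0 v1 v2 v3 where v: "v = (v0, v1, v2, v3)" by (cases v) auto
  define k where "k = kappa e m n v"
  have "kappa e m n (v0 - 12 * k, v1 - 2 * k * (6 * m + 2 * e), v2 - 2 * k * (6 * n + 2 * e),
      v3 - 2 * k * (6 * (m\<^sup>2 + m * n + n\<^sup>2 + e * (m + n)) + 3)) = kappa e m n v - k * (8 * e\<^sup>2 - 6)"
    unfolding v by (simp add: kappa_def power2_eq_square algebra_simps)
  then have "kappa e m n (triref e m n v) = kappa e m n v - k * (8 * e\<^sup>2 - 6)"
    unfolding triref_def v prod.case k_def .
  then show ?thesis
    using assms by (simp add: k_def)
qed

lemma triref_triref: "e\<^sup>2 = 1 \<Longrightarrow> triref e m n (triref e m n v) = v"
  using kappa_triref[of e m n v] unfolding triref_def[of e m n "triref e m n v"]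
  by (cases v) (simp add: triref_def)

text \<open>The maps \<open>f\<close> and \<open>g\<close> are parabolic and fix the pairs \<open>x, A\<close> and
  \<open>x, B\<close>; the displayed member is \<open>g\<^sup>i (f\<^sup>j (B - x))\<close>.\<close>
lemma chain_mem:
  fixes x A B h :: "int \<times> int \<times> int \<times> int" and i j :: nat
  assumes f: "\<And>v w. f (v + w) = f v + f w" "\<And>v w. f (v - w) = f v - f w" "\<And>k v. f (smul k v) = smul k (f v)"
      "f x = x" "f A = A" "f B = B + smul 2 h + smul 12 A" "f h = h + smul 12 A"
    and g: "\<And>v w. g (v + w) = g v + g w" "\<And>v w. g (v - w) = g v - g w" "\<And>k v. g (smul k v) = smul k (g v)"
      "g x = x" "g B = B" "g A = A + smul 2 h + smul 12 B" "g h = h + smul 12 B"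
    and S: "B - x \<in> S" "\<And>v. v \<in> S \<Longrightarrow> f v \<in> S" "\<And>v. v \<in> S \<Longrightarrow> g v \<in> S"
  shows "smul ((1 + 12 * int i * int j)\<^sup>2) B + smul (2 * int j + 24 * int i * (int j)\<^sup>2) h
     + smul (12 * (int j)\<^sup>2) A - x \<in> S" (is "?Z i j \<in> S")
proof -
  obtain A0 A1 A2 A3 where A: "A = (A0, A1, A2, A3)" by (cases A) auto
  obtain B0 B1 B2 B3 where B: "B = (B0, B1, B2, B3)" by (cases B) auto
  obtain h0 h1 h2 h3 where h: "h = (h0, h1, h2, h3)" by (cases h) auto
  \<comment> \<open>Up to \<open>- x\<close> the members are
    \<open>p\<^sup>2 B + 2 p q h + 12 q\<^sup>2 A\<close>. Here \<open>f\<close> sends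
    \<open>(p, q)\<close> to \<open>(p, p + q)\<close>, so \<open>j\<close> steps from
    \<open>(1, 0)\<close> reach \<open>(1, j)\<close>.\<close>
  have j: "?Z 0 j \<in> S" for j
  proof (induction j)
    case 0
    have "?Z 0 0 = B - x" by simp
    then show ?case using S(1) by simp
  next
    case (Suc j)
    have "?Z 0 (Suc j) = f (?Z 0 j)"
      unfolding f by (simp add: A B h smul_def power2_eq_square algebra_simps)
    then show ?case using S(2)[OF Suc] by simp
  qed
  \<comment> \<open>In the same parameters \<open>g\<close> sends \<open>(p, q)\<close> to
    \<open>(p + 12 q, q)\<close>, so \<open>i\<close> steps lead to
    \<open>(1 + 12 i j, j)\<close>.\<close>
  show ?thesis
  proof (induction i)
    case 0
    show ?case using j .
  next
    case (Suc i)
    have "?Z (Suc i) j = g (?Z i j)"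
      unfolding g by (simp add: A B h smul_def power2_eq_square algebra_simps)
    then show ?case using S(3)[OF Suc] by simp
  qed
qed

text \<open>Work modulo each prime \<open>p\<close> dividing \<open>a\<close>. If \<open>p\<close>
  does not divide \<open>B\<close>, a \<open>j\<close> divisible by \<open>p\<close> leaves only
  \<open>B\<close>. Otherwise \<open>j\<close> is prime to \<open>p\<close>, the value is
  \<open>2 * j\<close> times \<open>h + 6 * j * A + 12 * i * j * h\<close>, and \<open>i\<close> is
  divisible by \<open>p\<close> exactly when \<open>h + 6 * j * A\<close> is not.\<close>

lemma exists_coprime_value:
  fixes a A B h :: int
  assumes "odd a" and ABh: "\<And>p. prime p \<Longrightarrow> p dvd a \<Longrightarrow> p dvd A \<Longrightarrow> p dvd B \<Longrightarrow> \<not> p dvd h"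
    and three: "\<not> (3 dvd a \<and> 3 dvd B \<and> 3 dvd h)"
  shows "\<exists>i j :: nat. coprime a ((1 + 12 * int i * int j)\<^sup>2 * B + (2 * int j + 24 * int i * (int j)\<^sup>2) * h
    + 12 * (int j)\<^sup>2 * A)"
proof -
  have a0: "a \<noteq> 0" using assms(1) by auto
  have fin: "finite {q \<in> prime_factors a. Q q}" for Q
    by (rule finite_subset[OF _ finite_set_mset]) blast
  have prod_dvd: "p dvd \<Prod>{q \<in> prime_factors a. Q q} \<longleftrightarrow> Q p" if pp: "prime p" "p dvd a" for p Q
  proof
    assume "p dvd \<Prod>{q \<in> prime_factors a. Q q}"
    then obtain q where q: "q \<in> prime_factors a" "Q q" "p dvd q"
      using prime_dvd_prod_iff[OF fin pp(1), of "\<lambda>q. q"] by blast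
    then have "p = q"
      using pp(1) primes_dvd_imp_eq in_prime_factors_imp_prime by blast
    then show "Q p"
      using q by simp
  next
    assume "Q p"
    then show "p dvd \<Prod>{q \<in> prime_factors a. Q q}"
      using dvd_prodI[OF fin, of p Q "\<lambda>q. q"] pp a0 by (simp add: prime_factors_dvd)
  qed
  have nonneg: "\<Prod>{q \<in> prime_factors a. Q q} \<ge> 0" for Q
    by (rule prod_nonneg) (auto dest: in_prime_factors_imp_prime prime_ge_0_int)
  \<comment> \<open>Modulo a prime divisor of \<open>a\<close> only the vanishing of \<open>i\<close> and \<open>j\<close> matters, so products of
    primes replace the Chinese remainder theorem.\<close>
  define j where "j = \<Prod>{q \<in> prime_factors a. \<not> q dvd B}"
  define i where "i = \<Prod>{q \<in> prime_factors a. \<not> q dvd h + 6 * j * A}"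
  have "i \<ge> 0" "j \<ge> 0" unfolding i_def j_def by (rule nonneg)+
  have "\<not> p dvd (1 + 12 * i * j)\<^sup>2 * B + (2 * j + 24 * i * j\<^sup>2) * h + 12 * j\<^sup>2 * A"
    if p: "prime p" "p dvd a" for p
  proof
    assume dvd: "p dvd (1 + 12 * i * j)\<^sup>2 * B + (2 * j + 24 * i * j\<^sup>2) * h + 12 * j\<^sup>2 * A"
    have pj: "p dvd j \<longleftrightarrow> \<not> p dvd B" and pi: "p dvd i \<longleftrightarrow> \<not> p dvd h + 6 * j * A"
      unfolding i_def j_def by (rule prod_dvd[OF p])+
    have "p \<noteq> 2" using p assms(1) by auto
    then have p2: "\<not> p dvd 2"
      using p(1) primes_dvd_imp_eq[of p 2] by auto
    show False
    proof (cases "p dvd B")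
      case False
      have "(1 + 12 * i * j)\<^sup>2 * B + (2 * j + 24 * i * j\<^sup>2) * h + 12 * j\<^sup>2 * A
          = j * (24 * i * B + 144 * i\<^sup>2 * j * B + 2 * h + 24 * i * j * h + 12 * j * A) + B"
        by (simp add: power2_eq_square algebra_simps)
      then show False
        using dvd False pj by (metis dvd_add_right_iff dvd_mult2)
    next
      case True
      have "(1 + 12 * i * j)\<^sup>2 * B + (2 * j + 24 * i * j\<^sup>2) * h + 12 * j\<^sup>2 * A
          = (1 + 12 * i * j)\<^sup>2 * B + 2 * j * (h + 6 * j * A + i * (12 * j * h))"
        by (simp add: power2_eq_square algebra_simps)
      then have "p dvd 2 * j * (h + 6 * j * A + i * (12 * j * h))"
        using dvd True by (metis dvd_add_right_iff dvd_mult)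
      then have d: "p dvd h + 6 * j * A + i * (12 * j * h)"
        using p(1) p2 pj True by (simp add: prime_dvd_mult_iff)
      show False
      proof (cases "p dvd h + 6 * j * A")
        case False
        then show False
          using d pi by (metis dvd_add_left_iff dvd_mult2)
      next
        \<comment> \<open>Now \<open>p\<close> does not divide \<open>i\<close>, and
          \<open>12 * j * h\<close> can vanish only if \<open>p\<close> divides \<open>h\<close>;
          for \<open>p = 3\<close> this follows from \<open>hA\<close>. Then \<open>p\<close>
          divides \<open>6 * j * A\<close>, so it divides \<open>A\<close> or equals 3,
          contradicting \<open>ABh\<close> or \<open>three\<close>.\<close>
        case hA: True
        then have "p dvd i * (12 * j * h)"
          using d by (simp add: dvd_add_right_iff)
        then have "p dvd 2 * 2 * 3 \<or> p dvd h"
          using p(1) pi pj hA True by (simp add: prime_dvd_mult_iff)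
        then have "p dvd 3 \<or> p dvd h"
          using p(1) p2 by (simp only: prime_dvd_mult_iff) blast
        moreover have "p dvd h" if "p dvd 3"
        proof -
          have "p dvd 3 * (2 * j * A)" using that by (rule dvd_mult2)
          then have "p dvd 6 * j * A" by (simp add: algebra_simps)
          then show ?thesis using hA by (simp add: dvd_add_left_iff)
        qed
        ultimately have ph: "p dvd h" by blast
        then have "p dvd 2 * 3 * j * A"
          using hA by (simp add: dvd_add_right_iff)
        then have "p dvd 3 \<or> p dvd A"
          using p(1) p2 pj True by (simp only: prime_dvd_mult_iff) blast
        then have "p dvd 3"
          using ABh p True ph by blast
        then have "p = 3"
          using p(1) primes_dvd_imp_eq[of p 3] by simp
        then show False
          using three p(2) True ph by blast
      qed
    qed
  qed
  note no_prime = this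
  have "coprime a ((1 + 12 * i * j)\<^sup>2 * B + (2 * j + 24 * i * j\<^sup>2) * h + 12 * j\<^sup>2 * A)"
    (is "coprime a ?z")
  proof (rule ccontr)
    assume "\<not> coprime a ?z"
    then have "\<not> is_unit (gcd a ?z)"
      by (simp only: is_unit_gcd) simp
    moreover have "gcd a ?z \<noteq> 0"
      using a0 by (simp only: gcd_eq_0_iff) simp
    ultimately obtain p where "prime p" "p dvd gcd a ?z"
      using prime_divisor_exists by blast
    then show False
      using no_prime by auto
  qed
  then show ?thesis
    using \<open>i \<ge> 0\<close> \<open>j \<ge> 0\<close> by (intro exI[of _ "nat i"] exI[of _ "nat j"]) simp
qed

text \<open>The vectors \<open>x\<close>, \<open>A - 2 x\<close>, \<open>B - 2 x\<close> are
  triangular in the first three coordinates, and \<open>2 A + 2 B - 2 x - h\<close> is the last unit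
  vector.\<close>

lemma gridvec_span:
  fixes m n :: int
  defines "x \<equiv> gridvec m n"
  defines "A \<equiv> x + gridvec (m + 1) n" and "B \<equiv> x + gridvec m (n + 1)"
    and "h \<equiv> (6, 6 * m + 2, 6 * n + 2, 6 * (m\<^sup>2 + m * n + n\<^sup>2 + m + n) + 3)"
  shows "\<exists>p q r s. w = smul p x + smul q A + smul r B + smul s h"
proof -
  obtain w0 w1 w2 w3 where w: "w = (w0, w1, w2, w3)" by (cases w) auto
  define q r where "q = w1 - w0 * m" and "r = w2 - w0 * n"
  define t where "t = w3 - w0 * (m\<^sup>2 + m * n + n\<^sup>2) - q * (2 * m + n + 1) - r * (m + 2 * n + 1)"
  have w': "w1 = q + w0 * m" "w2 = r + w0 * n"
    "w3 = t + w0 * (m\<^sup>2 + m * n + n\<^sup>2) + q * (2 * m + n + 1) + r * (m + 2 * n + 1)"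
    by (simp_all add: q_def r_def t_def)
  have "w = smul (w0 - 2 * q - 2 * r - 2 * t) x + smul (q + 2 * t) A + smul (r + 2 * t) B + smul (- t) h"
    unfolding w w' A_def B_def x_def h_def gridvec_def smul_def
    by (simp add: power2_eq_square algebra_simps)
  then show ?thesis by blast
qed

section \<open>Coprime neighbours in the lattice\<close>

lemma coprime_tangent_gridvec:
  fixes l :: "int \<times> int \<times> int \<times> int \<Rightarrow> int"
  assumes add: "\<And>v w. l (v + w) = l v + l w"
    and prim: "\<And>d. (\<And>w. d dvd l w) \<Longrightarrow> is_unit d"
    and odd: "odd (l (gridvec m n))"
  shows "\<exists>w. (gridvec m n, w) \<in> tangent_pairs \<and> coprime (l (gridvec m n)) (l w)"
proof -
  define x where "x = gridvec m n"
  \<comment> \<open>These are the null vectors of the points where \<open>x\<close> touches its two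
    neighbours; \<open>h\<close> below is a multiple of the dual form of the triangle on all three
    circles.\<close>
  define A B where "A = x + gridvec (m + 1) n" and "B = x + gridvec m (n + 1)"
  define h :: "int \<times> int \<times> int \<times> int" where
    "h = (6, 6 * m + 2, 6 * n + 2, 6 * (m\<^sup>2 + m * n + n\<^sup>2 + m + n) + 3)"
  \<comment> \<open>Each map composes the reflections of the two triangles sharing an edge at
    \<open>x\<close>. Their dual circles touch at the midpoint of that edge, so the product is
    parabolic.\<close>
  define f g where "f = triref 1 m n \<circ> triref (- 1) (m + 1) n"
    and "g = triref 1 m n \<circ> triref (- 1) m (n + 1)"
  define S where "S = {w. (x, w) \<in> tangent_pairs}"
  note defs = x_def A_def B_def h_def
  note smul = additive_smul[of l, OF add] and diff = additive_diff[of l, OF add]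
  have fx: "f x = x" and fA: "f A = A" and fB: "f B = B + smul 2 h + smul 12 A" and fh: "f h = h + smul 12 A"
    unfolding f_def defs gridvec_def o_def
    by (simp_all add: triref_def kappa_def smul_def power2_eq_square algebra_simps)
  have gx: "g x = x" and gB: "g B = B" and gA: "g A = A + smul 2 h + smul 12 B" and gh: "g h = h + smul 12 B"
    unfolding g_def defs gridvec_def o_def
    by (simp_all add: triref_def kappa_def smul_def power2_eq_square algebra_simps)
  have S: "B - x \<in> S" "A - x \<in> S"
    unfolding S_def A_def B_def x_def by (simp_all add: tangent_pairs.right tangent_pairs.up)
  have fS: "f v \<in> S" if "v \<in> S" for v
    using that tangent_pairs.triref[of _ _ 1 m n] tangent_pairs.triref[of x v "-1" "m + 1" n] fx
    unfolding S_def f_def by fastforce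
  have gS: "g v \<in> S" if "v \<in> S" for v
    using that tangent_pairs.triref[of _ _ 1 m n] tangent_pairs.triref[of x v "-1" m "n + 1"] gx
    unfolding S_def g_def by fastforce
  have lin: "f (v + w) = f v + f w" "f (v - w) = f v - f w" "f (smul k v) = smul k (f v)"
    "g (v + w) = g v + g w" "g (v - w) = g v - g w" "g (smul k v) = smul k (g v)" for v w k
    by (simp_all add: f_def g_def triref_add triref_diff triref_smul)
  have no_prime: "\<not> p dvd l h" if "prime p" "p dvd l x" "p dvd l A" "p dvd l B" for p
  proof
    assume "p dvd l h"
    have "p dvd l w" for w
    proof -
      obtain a b c d where "w = smul a x + smul b A + smul c B + smul d h"
        using gridvec_span[of w m n, folded x_def, folded A_def B_def h_def] by blast
      then have "l w = a * l x + b * l A + c * l B + d * l h"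
        by (simp only: add smul)
      then show ?thesis
        using that(2-4) \<open>p dvd l h\<close> by (simp only: dvd_add dvd_mult)
    qed
    then show False
      using prim[of p] that(1) not_prime_unit by blast
  qed
  have conclude: ?thesis
    if "v - x \<in> S" "coprime (l x) (l v)" for v
  proof -
    \<comment> \<open>The members are neighbours of \<open>x\<close>, and adding \<open>x\<close> to
      one does not change the gcd with \<open>l x\<close>.\<close>
    have "coprime (l x) (l (v - x))"
      using that(2) unfolding diff coprime_iff_gcd_eq_1 by (metis gcd_diff1 gcd.commute)
    then show ?thesis
      using that(1) unfolding S_def x_def by blast
  qed
  show ?thesis
  proof (cases "3 dvd l x \<and> 3 dvd l B \<and> 3 dvd l h")
    case False
    then obtain i j :: nat where "coprime (l x) ((1 + 12 * int i * int j)\<^sup>2 * l B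
        + (2 * int j + 24 * int i * (int j)\<^sup>2) * l h + 12 * (int j)\<^sup>2 * l A)"
      using exists_coprime_value[of "l x" "l A" "l B" "l h"] odd no_prime unfolding x_def by blast
    then show ?thesis
      using conclude[OF chain_mem[of f x A B h g, OF lin(1-3) fx fA fB fh lin(4-6) gx gB gA gh S(1) fS gS, of i j]]
      by (simp only: add smul)
  next
    \<comment> \<open>The values of the first family are all divisible by 3, so the roles of \<open>A\<close> and \<open>B\<close> are swapped.\<close>
    case True
    then have "\<not> 3 dvd l A"
      using no_prime[of 3] by auto
    then obtain i j :: nat where "coprime (l x) ((1 + 12 * int i * int j)\<^sup>2 * l A
        + (2 * int j + 24 * int i * (int j)\<^sup>2) * l h + 12 * (int j)\<^sup>2 * l B)"
      using exists_coprime_value[of "l x" "l B" "l A" "l h"] odd no_prime unfolding x_def by blast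
    then show ?thesis
      using conclude[OF chain_mem[of g x B A h f, OF lin(4-6) gx gB gA gh lin(1-3) fx fA fB fh S(2) gS fS, of i j]]
      by (simp only: add smul)
  qed
qed

text \<open>The reflection is moved from the vector to the functional. As an involution it preserves
  primitivity of \<open>l\<close>, which reduces everything to grid vectors.\<close>

lemma coprime_tangent:
  fixes l :: "int \<times> int \<times> int \<times> int \<Rightarrow> int"
  assumes "v \<in> orbit" and "\<And>v w. l (v + w) = l v + l w"
    and "\<And>d. (\<And>w. d dvd l w) \<Longrightarrow> is_unit d" and "odd (l v)"
  shows "\<exists>w. (v, w) \<in> tangent_pairs \<and> coprime (l v) (l w)"
  using assms
proof (induction v arbitrary: l)
  case (gridvec m n)
  then show ?case by (rule coprime_tangent_gridvec)
next
  case (triref v e m n)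
  have "\<exists>w. (v, w) \<in> tangent_pairs \<and> coprime ((l \<circ> triref e m n) v) ((l \<circ> triref e m n) w)"
  proof (rule triref.IH)
    fix d assume d: "\<And>w. d dvd (l \<circ> triref e m n) w"
    have "d dvd l w" for w
      using d[of "triref e m n w"] triref_triref[OF triref.hyps(2)] by simp
    then show "is_unit d" by (rule triref.prems(2))
  qed (use triref.prems in \<open>simp_all add: triref_add\<close>)
  then obtain w where w: "(v, w) \<in> tangent_pairs"
    "coprime (l (triref e m n v)) (l (triref e m n w))"
    unfolding o_def by blast
  then show ?case
    using tangent_pairs.triref[OF w(1) triref.hyps(2)] by blast
qed

section \<open>From lattice functionals to curvatures\<close>

lemma evec_add: "evec (v + w) = evec v + evec w"
proof -
  obtain v0 v1 v2 v3 w0 w1 w2 w3 where "v = (v0, v1, v2, v3)" "w = (w0, w1, w2, w3)"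
    by (metis surj_pair)
  then show ?thesis
    by (simp add: evec_def lat_def algebra_simps)
qed

text \<open>The grid vectors alone already span the integer lattice.\<close>

lemma additive_Ints:
  fixes f :: "int \<times> int \<times> int \<times> int \<Rightarrow> real"
  assumes add: "\<And>v w. f (v + w) = f v + f w" and orbit: "\<And>v. v \<in> orbit \<Longrightarrow> f v \<in> \<int>"
  shows "f w \<in> \<int>"
proof -
  define I where "I = {v. f v \<in> \<int>}"
  have zero: "f 0 = 0" using add[of 0 0] by simp
  have minus: "f (- v) = - f v" for v using add[of v "- v"] zero by simp
  have I_add: "v + w \<in> I" if "v \<in> I" "w \<in> I" for v w
    using that by (simp add: I_def add)
  have I_minus: "- v \<in> I" if "v \<in> I" for v
    using that by (simp add: I_def minus)
  have I_smul: "smul k v \<in> I" if "v \<in> I" for k v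
  proof (induction k rule: int_induct[where k = 0])
    case base
    then show ?case by (simp add: I_def zero)
  next
    case (step1 k)
    then show ?case using I_add that smul_add_left[of k 1 v] by simp
  next
    case (step2 k)
    then show ?case using I_add[OF step2(2) I_minus[OF that]] smul_add_left[of "k - 1" 1 v] by simp
  qed
  have g: "gridvec m n \<in> I" for m n
    using orbit[OF orbit.gridvec] by (simp add: I_def)
  define x where "x = gridvec 0 0"
  \<comment> \<open>This combination of grid vectors is the \<open>h\<close> of
    \<open>gridvec_span\<close> at the origin.\<close>
  define A B h where "A = x + gridvec 1 0" and "B = x + gridvec 0 1"
    and "h = gridvec 1 0 + smul 3 (gridvec 0 1) - gridvec (- 1) 1 + smul 3 x"
  have mem: "x \<in> I" "A \<in> I" "B \<in> I" "h \<in> I"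
    unfolding A_def B_def h_def x_def diff_conv_add_uminus
    by (intro I_add I_minus I_smul g)+
  have h_eq: "h = (6, 6 * 0 + 2, 6 * 0 + 2, 6 * (0\<^sup>2 + 0 * 0 + 0\<^sup>2 + 0 + 0) + 3)"
    unfolding h_def x_def by (simp add: gridvec_def smul_def)
  obtain p q r s where "w = smul p x + smul q A + smul r B + smul s h"
    using gridvec_span[of w 0 0, unfolded add_0, folded x_def h_eq[unfolded add_0], folded A_def B_def] by blast
  then have "w \<in> I"
    using I_add I_smul mem by metis
  then show ?thesis by (simp add: I_def)
qed

text \<open>The leading coefficient of the transformed form is additive on the lattice and agrees
  with curvature up to sign on the orbit, so integrality and primitivity of the packing pass to
  it.\<close>

lemma exists_tangent_coprime_curvature:
  assumes P: "triangular_packing P" "integral_packing P" "primitive_packing P"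
    and C: "C \<in> P" "curvature P C = of_int a" and "odd a"
  obtains D b where "D \<in> P" "tangent C D" "curvature P D = of_int b" "coprime a b"
proof -
  obtain p q r s where det: "p * s - q * r = 1" and P_eq: "P = {zeros (hmoeb p q r s (evec v)) | v. v \<in> orbit}"
    by (rule triangular_packing_eq[OF P(1)])
  define Z where "Z v = zeros (hmoeb p q r s (evec v))" for v
  define f where "f v = fst (hmoeb p q r s (evec v))" for v
  have f_add: "f (v + w) = f v + f w" for v w
    by (simp add: f_def evec_add hmoeb_add)
  have curv: "\<bar>curvature P (Z v)\<bar> = \<bar>f v\<bar>" if "v \<in> orbit" for v
    unfolding Z_def f_def by (rule abs_curvature_zeros) (simp add: hpair_hmoeb[OF det] hpair_evec_orbit that)
  have P_Z: "P = Z ` orbit"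
    unfolding P_eq Z_def by blast
  then have Z_mem: "Z v \<in> P" if "v \<in> orbit" for v
    using that by blast
  have "f v \<in> \<int>" if "v \<in> orbit" for v
  proof -
    have "curvature P (Z v) \<in> \<int>"
      using P(2) Z_mem[OF that] unfolding integral_packing_def by blast
    then have "\<bar>f v\<bar> \<in> \<int>"
      using curv[OF that] by (metis Ints_abs)
    then show ?thesis
      by (metis Ints_minus abs_if minus_minus)
  qed
  then have "f w \<in> \<int>" for w
    by (rule additive_Ints[OF f_add])
  define l where "l w = \<lfloor>f w\<rfloor>" for w
  have l: "f w = of_int (l w)" for w
    using \<open>f w \<in> \<int>\<close> by (simp add: l_def of_int_floor)
  have l_add: "l (v + w) = l v + l w" for v w
    using f_add[of v w] unfolding l by linarith
  have curv_l: "\<bar>k\<bar> = \<bar>l v\<bar>" if "v \<in> orbit" "curvature P (Z v) = of_int k" for v k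
    using curv[OF that(1)] unfolding that(2) l by linarith
  \<comment> \<open>A common divisor of all values of \<open>l\<close> divides every curvature,
    hence their gcd 1.\<close>
  have unit: "is_unit d" if "\<And>w. d dvd l w" for d
  proof -
    have "d dvd k" if k: "k \<in> int_curvatures P" for k
    proof -
      obtain E where E: "E \<in> P" "curvature P E = of_int k"
        using k unfolding int_curvatures_def by blast
      then obtain v where "v \<in> orbit" "E = Z v"
        unfolding P_Z by blast
      then have "v \<in> orbit" "curvature P (Z v) = of_int k"
        using E(2) by simp_all
      then show ?thesis
        using curv_l \<open>\<And>w. d dvd l w\<close> by (metis dvd_abs_iff)
    qed
    then have "d dvd Gcd (int_curvatures P)"
      by (rule Gcd_greatest)
    then show ?thesis
      using P(3) by (simp add: primitive_packing_def)
  qed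
  obtain v where v: "v \<in> orbit" "C = Z v"
    using C(1) unfolding P_Z by blast
  then have a: "\<bar>a\<bar> = \<bar>l v\<bar>"
    using curv_l C(2) by blast
  then have "odd (l v)"
    using \<open>odd a\<close> by (metis dvd_abs_iff)
  then obtain w where w: "(v, w) \<in> tangent_pairs" "coprime (l v) (l w)"
    using coprime_tangent[OF v(1), of l] l_add unit by blast
  obtain b where b: "curvature P (Z w) = of_int b"
    using P(2) Z_mem tangent_pairsD(2)[OF w(1)] unfolding integral_packing_def by (metis Ints_cases)
  then have "\<bar>b\<bar> = \<bar>l w\<bar>"
    using curv_l tangent_pairsD(2)[OF w(1)] by blast
  then have "coprime a b"
    using w(2) a by (metis coprime_abs_left_iff coprime_abs_right_iff)
  moreover have "tangent C (Z w)"
    unfolding v(2) Z_def by (rule tangent_zeros_hmoeb[OF det w(1)])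
  ultimately show ?thesis
    using that b Z_mem tangent_pairsD(2)[OF w(1)] by blast
qed

section \<open>Kronecker symbols over squares\<close>

lemma kronecker_prime_square:
  assumes "prime p" "\<not> int p dvd m"
  shows "kronecker_prime m p * kronecker_prime m p = 1"
  using assms by (auto simp: kronecker_prime_def Legendre_def cong_0_iff)

text \<open>No prime of \<open>n\<close> divides \<open>m\<close>, so each factor is 1 or -1. The
  square of the product is what a symbol over \<open>n\<^sup>2\<close> amounts to.\<close>

lemma prod_mset_kronecker_prime_square:
  assumes "coprime m n" "n \<noteq> 0"
  shows "(\<Prod>p \<in># prime_factorization (nat \<bar>n\<bar>). kronecker_prime m p) *
    (\<Prod>p \<in># prime_factorization (nat \<bar>n\<bar>). kronecker_prime m p) = 1"
proof -
  have "kronecker_prime m p * kronecker_prime m p = 1" if "p \<in># prime_factorization (nat \<bar>n\<bar>)" for p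
  proof (rule kronecker_prime_square)
    show "prime p" using that by (rule in_prime_factors_imp_prime)
    have "p dvd nat \<bar>n\<bar>" using that by (rule in_prime_factors_imp_dvd)
    then have "int p dvd n" using assms(2) by (simp add: int_dvd_int_iff[symmetric])
    then show "\<not> int p dvd m"
      using assms(1) \<open>prime p\<close> by (metis coprime_common_divisor not_prime_unit prime_nat_int_transfer)
  qed
  then have "(\<Prod>p \<in># prime_factorization (nat \<bar>n\<bar>). kronecker_prime m p * kronecker_prime m p) = 1"
    by (simp add: prod_mset.neutral cong: image_mset_cong)
  then show ?thesis
    by (simp add: prod_mset.distrib)
qed

lemma nat_abs_square: "nat \<bar>n\<^sup>2\<bar> = nat \<bar>n\<bar> * nat \<bar>n\<bar>" for n :: int
proof -
  have "nat \<bar>n * n\<bar> = nat \<bar>n\<bar> * nat \<bar>n\<bar>"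
    unfolding abs_mult by (rule nat_mult_distrib) simp
  then show ?thesis
    by (simp only: power2_eq_square)
qed

lemma kronecker_square:
  assumes "coprime m n" "n \<noteq> 0"
  shows "kronecker m (n\<^sup>2) = 1"
  using prod_mset_kronecker_prime_square[OF assms] assms(2)
  unfolding kronecker_def nat_abs_square
  by (simp add: prime_factorization_mult)

text \<open>The prime 3 contributes one factor beyond the square part. This remains true when 3
  divides \<open>n\<close>, since \<open>m\<close> is then prime to 3.\<close>

lemma kronecker_three_square:
  assumes "coprime m n" "n \<noteq> 0"
  shows "kronecker m (3 * n\<^sup>2) = Legendre m 3"
proof -
  have "nat \<bar>3 * n\<^sup>2\<bar> = 3 * (nat \<bar>n\<bar> * nat \<bar>n\<bar>)"
    unfolding nat_abs_square[symmetric] by (simp add: abs_mult nat_mult_distrib)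
  moreover have "prime_factorization (3::nat) = {#3#}"
    by (simp add: prime_factorization_prime)
  ultimately show ?thesis
    using prod_mset_kronecker_prime_square[OF assms] assms(2)
    unfolding kronecker_def by (simp add: prime_factorization_mult kronecker_prime_def[of _ 3])
qed

lemma Legendre_3_eq_minus_one:
  assumes "m mod 3 = 2"
  shows "Legendre m 3 = - 1"
proof -
  have "y\<^sup>2 mod 3 \<noteq> 2" for y :: int
  proof -
    have "y mod 3 = 0 \<or> y mod 3 = 1 \<or> y mod 3 = 2" by presburger
    then show ?thesis
      unfolding power_mod[of y 3 2, symmetric] by auto
  qed
  then have "\<not> QuadRes 3 m"
    using assms by (simp add: QuadRes_def cong_def)
  then show ?thesis
    using assms by (simp add: Legendre_def cong_def)
qed

theorem theorem6p16:
  fixes P :: "ecomplex set set"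
  assumes "triangular_packing P" and "integral_packing P" and "primitive_packing P"
  shows "((\<forall>k \<in> int_curvatures P. [k = 1] (mod 12)) \<and>
          (\<forall>C \<in> P. \<forall>D \<in> P. \<forall>a b :: int.
             tangent C D \<and> curvature P C = of_int a \<and> curvature P D = of_int b \<and>
             a \<noteq> 0 \<and> gcd a b = 1 \<longrightarrow> kronecker (a + b) a = - 1)
          \<longrightarrow> \<not> (\<exists>C \<in> P. \<exists>n :: int. curvature P C = of_int (n ^ 2)))
       \<and> ((\<forall>k \<in> int_curvatures P. [k = 3] (mod 12) \<or> [k = 11] (mod 12)) \<and>
          (\<forall>C \<in> P. \<forall>D \<in> P. \<forall>a b :: int.
             tangent C D \<and> curvature P C = of_int a \<and> curvature P D = of_int b \<and>
             a \<noteq> 0 \<and> gcd a b = 1 \<longrightarrow> chi a b = - 1)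
          \<longrightarrow> \<not> (\<exists>C \<in> P. \<exists>n :: int. curvature P C = of_int (3 * n ^ 2)))"
proof (intro conjI impI)
  assume H: "(\<forall>k \<in> int_curvatures P. [k = 1] (mod 12)) \<and>
          (\<forall>C \<in> P. \<forall>D \<in> P. \<forall>a b :: int.
             tangent C D \<and> curvature P C = of_int a \<and> curvature P D = of_int b \<and>
             a \<noteq> 0 \<and> gcd a b = 1 \<longrightarrow> kronecker (a + b) a = - 1)"
  show "\<not> (\<exists>C \<in> P. \<exists>n :: int. curvature P C = of_int (n ^ 2))"
  proof
    assume "\<exists>C \<in> P. \<exists>n :: int. curvature P C = of_int (n ^ 2)"
    then obtain C n where C: "C \<in> P" "curvature P C = of_int (n\<^sup>2)" by blast
    then have "[n\<^sup>2 = 1] (mod 12)"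
      using H unfolding int_curvatures_def by blast
    then have "n\<^sup>2 mod 12 = 1"
      by (simp add: cong_def)
    moreover have "odd k" if "k mod 12 = 1" for k :: int
      using that by presburger
    ultimately have "odd (n\<^sup>2)" by blast
    then obtain D b where D: "D \<in> P" "tangent C D" "curvature P D = of_int b" "coprime (n\<^sup>2) b"
      using exists_tangent_coprime_curvature[OF assms C] by blast
    have "n \<noteq> 0" using \<open>odd (n\<^sup>2)\<close> by auto
    moreover have "gcd (n\<^sup>2) b = 1"
      using D(4) by (simp only: coprime_iff_gcd_eq_1)
    ultimately have "kronecker (n\<^sup>2 + b) (n\<^sup>2) = - 1"
      using conjunct2[OF H, rule_format, OF C(1) D(1), of "n\<^sup>2" b] C(2) D(2,3) by simp
    \<comment> \<open>Coprimality with \<open>n\<close> makes the symbol over the square 1, against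
      the hypothesis.\<close>
    moreover have "coprime (n\<^sup>2 + b) n"
    proof -
      have "coprime (n\<^sup>2 + b) (n\<^sup>2)"
        using D(4) by (simp add: coprime_commute coprime_iff_gcd_eq_1 gcd.commute)
      then show ?thesis by simp
    qed
    ultimately show False
      using kronecker_square[of "n\<^sup>2 + b" n] \<open>n \<noteq> 0\<close> by simp
  qed
next
  assume H: "(\<forall>k \<in> int_curvatures P. [k = 3] (mod 12) \<or> [k = 11] (mod 12)) \<and>
          (\<forall>C \<in> P. \<forall>D \<in> P. \<forall>a b :: int.
             tangent C D \<and> curvature P C = of_int a \<and> curvature P D = of_int b \<and>
             a \<noteq> 0 \<and> gcd a b = 1 \<longrightarrow> chi a b = - 1)"
  show "\<not> (\<exists>C \<in> P. \<exists>n :: int. curvature P C = of_int (3 * n ^ 2))"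
  proof
    assume "\<exists>C \<in> P. \<exists>n :: int. curvature P C = of_int (3 * n ^ 2)"
    then obtain C n where C: "C \<in> P" "curvature P C = of_int (3 * n\<^sup>2)" by blast
    define a where "a = 3 * n\<^sup>2"
    have mod12: "k mod 12 = 3 \<or> k mod 12 = 11" if "E \<in> P" "curvature P E = of_int k" for E k
      using H that unfolding int_curvatures_def cong_def by fastforce
    have a: "a mod 12 = 3 \<or> a mod 12 = 11"
      using mod12 C unfolding a_def by blast
    then have "odd a" by presburger
    then obtain D b where D: "D \<in> P" "tangent C D" "curvature P D = of_int b" "coprime a b"
      using exists_tangent_coprime_curvature[OF assms, of C a] C unfolding a_def by blast
    have "n \<noteq> 0" using \<open>odd a\<close> by (auto simp: a_def)
    have "a \<noteq> 0" using \<open>odd a\<close> by auto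
    moreover have "gcd a b = 1"
      using D(4) by (simp only: coprime_iff_gcd_eq_1)
    ultimately have chi: "chi a b = - 1"
      by (intro conjunct2[OF H, rule_format, OF C(1) D(1), of a b] conjI D(2,3))
        (simp_all only: a_def C(2) not_False_eq_True)
    have "a mod 3 = 0" by (simp add: a_def)
    \<comment> \<open>A multiple of 3 is never 11 modulo 12, so \<open>chi\<close> takes its negated
      branch.\<close>
    have "a mod 12 \<noteq> 11" using \<open>a mod 3 = 0\<close> by presburger
    then have chi_eq: "chi a b = - kronecker (a + b) a"
      by (simp add: chi_def cong_def)
    \<comment> \<open>Since 3 divides \<open>a\<close>, coprimality leaves 11 as the only residue of
      \<open>b\<close> modulo 12. Hence \<open>a + b\<close> is 2 modulo 3, a nonresidue, and
      \<open>chi a b\<close> comes out as 1.\<close>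
    have "\<not> 3 dvd b"
    proof
      assume "3 dvd b"
      then have "is_unit (3 :: int)"
        using D(4) \<open>a mod 3 = 0\<close> by (metis coprime_common_divisor dvd_eq_mod_eq_0)
      then show False by simp
    qed
    then have "b mod 12 = 11"
      using mod12[OF D(1,3)] by presburger
    then have "(a + b) mod 3 = 2"
      using \<open>a mod 3 = 0\<close> by presburger
    moreover have "coprime (a + b) n"
    proof -
      have "coprime (a + b) a"
        using D(4) by (simp add: coprime_commute coprime_iff_gcd_eq_1 gcd.commute)
      then show ?thesis by (simp add: a_def)
    qed
    ultimately have "kronecker (a + b) a = - 1"
      using kronecker_three_square[of "a + b" n] Legendre_3_eq_minus_one \<open>n \<noteq> 0\<close>
      by (simp add: a_def)
    then show False
      using chi chi_eq by simp
  qed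
qed

end
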